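(* Let $\mathcal{A}$ be a Banach algebra with a (uniformly bounded) $d$-parameter automorphism group $\Psi$. If $1\le p,q\le\infty$ and $r,s>0$, then $$\Lambda^q_s\bigl(\Lambda^p_r(\mathcal{A})\bigr)=\Lambda^q_{r+s}(\mathcal{A}),$$ where equality means equality as sets with equivalent norms.
   Context: Banach algebras are complex and unital; a Banach space with a multiplication satisfying $\|ab\|\le C\|a\|\|b\|$ is regarded as a Banach algebra, and Banach spaces with equivalent norms are regarded as equal. A $d$-parameter automorphism group acting on a Banach algebra $\mathcal{A}$ is a family $\Psi=\{\psi_t\}_{t\in\mathbb{R}^d}$ of Banach algebra automorphisms of $\mathcal{A}$ with $\psi_s\psi_t=\psi_{s+t}$ for all $s,t\in\mathbb{R}^d$ (consisting of $*$-automorphisms if $\mathcal{A}$ is a $*$-algebra). It is always assumed uniformly bounded: $M_\Psi=\sup_{t\in\mathbb{R}^d}\|\psi_t\|_{\mathcal{A}\to\mathcal{A}}<\infty$. Strong continuity of $t\mapsto\psi_t(a)$ is not assumed. Put $\Delta_t=\psi_t-\mathrm{id}$, $\Delta_t^k=(\psi_t-\mathrm{id})^k$ and $\omega^k_h(a)=\sup_{|t|\le h}\|\Delta_t^k a\|_{\mathcal{A}}$ for $h>0$, where $|t|=\sum_j|t_j|$ (any other norm on $\mathbb{R}^d$ gives the same spaces with equivalent norms). For $1\le p\le\infty$, $r>0$ and $l=\lfloor r\rfloor+1$, the Besov space $\Lambda^p_r(\mathcal{A})$ consists of all $a\in\mathcal{A}$ for which $\|a\|_{\Lambda^p_r(\mathcal{A})}=\|a\|_{\mathcal{A}}+\bigl(\int_0^\infty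 (h^{-r}\omega^l_h(a))^p\,\frac{dh}{h}\bigr)^{1/p}$ is finite (for $p=\infty$: $\|a\|_{\mathcal{A}}+\sup_{h>0}h^{-r}\omega^l_h(a)$, up to equivalence of norms). The group $\Psi$ restricts to a uniformly bounded group on $\Lambda^p_r(\mathcal{A})$, and $\Lambda^q_s(\Lambda^p_r(\mathcal{A}))$ is the Besov space defined in the same way with $\mathcal{A}$ replaced by $\Lambda^p_r(\mathcal{A})$ and $\Psi$ by its restriction. *)

theory Defs
  imports "HOL-Analysis.Analysis"
begin

class scaleC = scaleR +
  fixes scaleC :: "complex \<Rightarrow> 'a \<Rightarrow> 'a"  (infixr \<open>*\<^sub>C\<close> 75)
  assumes scaleR_scaleC: "r *\<^sub>R x = complex_of_real r *\<^sub>C x"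

text \<open>
  The multiplication is only required to be bounded, with some constant \<open>C\<close>; neither \<open>C = 1\<close> nor
  \<open>norm 1 = 1\<close> is assumed (the class \<open>real_normed_algebra_1\<close> would impose both).
\<close>

class complex_banach_algebra = scaleC + banach + ring + monoid_mult +
  assumes scaleC_add_right: "c *\<^sub>C (x + y) = c *\<^sub>C x + c *\<^sub>C y"
    and scaleC_add_left: "(b + c) *\<^sub>C x = b *\<^sub>C x + c *\<^sub>C x"
    and scaleC_scaleC: "b *\<^sub>C c *\<^sub>C x = (b * c) *\<^sub>C x"
    and scaleC_one: "1 *\<^sub>C x = x"
    and norm_scaleC: "norm (c *\<^sub>C x) = cmod c * norm x"
    and mult_scaleC_left: "(c *\<^sub>C x) * y = c *\<^sub>C (x * y)"
    and mult_scaleC_right: "x * (c *\<^sub>C y) = c *\<^sub>C (x * y)"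
    and norm_mult_bounded: "\<exists>C. \<forall>x y. norm (x * y) \<le> C * norm x * norm y"

text \<open>Boundedness of the inverse follows from the open mapping theorem.\<close>

definition banach_algebra_automorphism ::
    "('a::complex_banach_algebra \<Rightarrow> 'a) \<Rightarrow> bool" where
  "banach_algebra_automorphism \<phi> \<longleftrightarrow>
     bij \<phi> \<and> bounded_linear \<phi> \<and> (\<forall>c x. \<phi> (c *\<^sub>C x) = c *\<^sub>C \<phi> x) \<and>
     (\<forall>x y. \<phi> (x * y) = \<phi> x * \<phi> y) \<and> \<phi> 1 = 1"

locale automorphism_group =
  fixes \<psi> :: "real ^ 'd \<Rightarrow> 'a::complex_banach_algebra \<Rightarrow> 'a"
  assumes automorphism: "banach_algebra_automorphism (\<psi> t)"
    and group_law: "\<psi> s \<circ> \<psi> t = \<psi> (s + t)"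
    and uniformly_bounded: "bdd_above (range (\<lambda>t. onorm (\<psi> t)))"

text \<open>
  A normed space \<open>X\<close> contained in \<open>'a\<close> is represented by its norm, extended by \<open>\<infinity>\<close> outside \<open>X\<close>;
  thus \<open>X = {a. N a < \<infinity>}\<close>. This allows the Besov construction to be iterated, with the restriction
  of the group to a Besov space given by the same function \<open>\<psi>\<close>.
\<close>

definition ennreal_powr :: "ennreal \<Rightarrow> real \<Rightarrow> ennreal" where
  \<comment> \<open>only used for exponents \<open>\<alpha> > 0\<close>\<close>
  "ennreal_powr x \<alpha> = (if x = \<infinity> then \<infinity> else ennreal (enn2real x powr \<alpha>))"

definition group_difference :: "(real ^ 'd \<Rightarrow> 'a \<Rightarrow> 'a) \<Rightarrow> real ^ 'd \<Rightarrow> 'a \<Rightarrow> 'a::ab_group_add" where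
  "group_difference \<psi> t a = \<psi> t a - a"

definition smoothness_modulus ::
    "(real ^ 'd \<Rightarrow> 'a \<Rightarrow> 'a::ab_group_add) \<Rightarrow> ('a \<Rightarrow> ennreal) \<Rightarrow> nat \<Rightarrow> real \<Rightarrow> 'a \<Rightarrow> ennreal" where
  "smoothness_modulus \<psi> N k h a =
     (SUP t\<in>{t. (\<Sum>j\<in>UNIV. \<bar>t $ j\<bar>) \<le> h}. N ((group_difference \<psi> t ^^ k) a))"

definition besov_seminorm ::
    "(real ^ 'd \<Rightarrow> 'a \<Rightarrow> 'a::ab_group_add) \<Rightarrow> ennreal \<Rightarrow> real \<Rightarrow> ('a \<Rightarrow> ennreal) \<Rightarrow> 'a \<Rightarrow> ennreal" where
  "besov_seminorm \<psi> p r N a =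
     (let l = nat \<lfloor>r\<rfloor> + 1;
          w = (\<lambda>h. ennreal (h powr (- r)) * smoothness_modulus \<psi> N l h a)
      in if p = \<infinity> then (SUP h\<in>{0<..}. w h)
         else ennreal_powr
                (\<integral>\<^sup>+h\<in>{0<..}. (ennreal_powr (w h) (enn2real p) * ennreal (1 / h)) \<partial>lborel)
                (1 / enn2real p))"

definition besov_norm ::
    "(real ^ 'd \<Rightarrow> 'a \<Rightarrow> 'a::ab_group_add) \<Rightarrow> ennreal \<Rightarrow> real \<Rightarrow> ('a \<Rightarrow> ennreal) \<Rightarrow> 'a \<Rightarrow> ennreal" where
  "besov_norm \<psi> p r N a = N a + besov_seminorm \<psi> p r N a"

definition space_of_norm :: "('a \<Rightarrow> ennreal) \<Rightarrow> 'a set" where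
  "space_of_norm N = {a. N a < \<infinity>}"

definition equivalent_norms_on :: "'a set \<Rightarrow> ('a \<Rightarrow> ennreal) \<Rightarrow> ('a \<Rightarrow> ennreal) \<Rightarrow> bool" where
  "equivalent_norms_on X N N' \<longleftrightarrow>
     (\<exists>c C :: real. 0 < c \<and> 0 < C \<and> (\<forall>a\<in>X. ennreal c * N a \<le> N' a \<and> N' a \<le> ennreal C * N a))"

abbreviation algebra_norm :: "'a::complex_banach_algebra \<Rightarrow> ennreal" where
  "algebra_norm a \<equiv> ennreal (norm a)"

end

theory Submission
  imports Defs
begin

text \<open>
  Orbits need not be measurable, so nothing is integrated over the group: every bound is first made
  for the moduli at dyadic scales, and only the variable \<open>h\<close> is integrated, in \<open>L\<^sup>p(dh / h)\<close>, whose
  norm is invariant under \<open>h \<mapsto> c h\<close> and countably subadditive. Iterating Marchaud's inequality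
  \<open>\<omega>\<^sup>k\<^sub>h \<le> C \<omega>\<^sup>k\<^sup>+\<^sup>1\<^sub>h + 2\<^sup>-\<^sup>k \<omega>\<^sup>k\<^sub>2\<^sub>h\<close> shows that the order of the modulus may be raised at will.

  If \<open>N\<^sub>1\<close> is the norm of \<open>\<Lambda>\<^sup>p\<^sub>r\<close>, then \<open>h\<^sup>-\<^sup>r \<omega>\<^sup>l\<^sub>h(b) \<le> C N\<^sub>1(b)\<close> with \<open>b = \<Delta>\<^sub>t\<^sup>m a\<close> bounds the modulus
  of order \<open>l + m\<close> of \<open>a\<close> by \<open>h\<^sup>r\<close> times the modulus of order \<open>m\<close> for \<open>N\<^sub>1\<close>. Conversely,
  discretizing at the scales \<open>2\<^sup>j h\<close> gives, for every \<open>h > 0\<close>,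
  \<open>N\<^sub>1(b) \<le> N(b) + C h\<^sup>-\<^sup>r (N(b) + \<Sum>\<^sub>j 2\<^sup>j\<^sup>r \<omega>\<^sup>n(2\<^sup>-\<^sup>j h, b))\<close>, to be used with \<open>b = \<Delta>\<^sub>t\<^sup>n a\<close> and \<open>|t| \<le> h\<close>.
  Here \<open>n > r + s\<close> is essential, which is why the order of the outer modulus is raised beforehand.
\<close>

section \<open>The spaces \<open>L\<^sup>p(dh / h)\<close>\<close>

lemma ennreal_powr_ennreal: "ennreal_powr (ennreal x) \<alpha> = ennreal (max 0 x powr \<alpha>)"
  by (auto simp: ennreal_powr_def max_def ennreal_neg)

lemma ennreal_powr_mono:
  assumes "x \<le> y" "0 \<le> \<alpha>"
  shows "ennreal_powr x \<alpha> \<le> ennreal_powr y \<alpha>"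
  using assms by (cases x; cases y) (auto simp: ennreal_powr_def intro!: powr_mono2 simp: top_unique)

lemma ennreal_powr_powr_inverse:
  assumes "\<alpha> \<noteq> 0"
  shows "ennreal_powr (ennreal_powr x \<alpha>) (1 / \<alpha>) = x" "ennreal_powr (ennreal_powr x (1 / \<alpha>)) \<alpha> = x"
  using assms by (cases x; simp add: ennreal_powr_def powr_powr)+

lemma ennreal_powr_le_iff:
  assumes "0 < \<alpha>"
  shows "ennreal_powr x (1 / \<alpha>) \<le> y \<longleftrightarrow> x \<le> ennreal_powr y \<alpha>"
  using assms ennreal_powr_mono[of "ennreal_powr x (1 / \<alpha>)" y \<alpha>]
    ennreal_powr_mono[of x "ennreal_powr y \<alpha>" "1 / \<alpha>"]
  by (auto simp: ennreal_powr_powr_inverse)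

lemma ennreal_powr_mult:
  assumes "0 < \<alpha>"
  shows "ennreal_powr (x * y) \<alpha> = ennreal_powr x \<alpha> * ennreal_powr y \<alpha>"
  using assms
  by (cases x; cases y)
     (auto simp: ennreal_powr_def powr_mult ennreal_mult_top ennreal_top_mult simp flip: ennreal_mult)

lemma measurable_ennreal_powr [measurable]:
  "(\<lambda>x. ennreal_powr (f x) \<alpha>) \<in> borel_measurable M" if [measurable]: "f \<in> borel_measurable M"
  unfolding ennreal_powr_def by measurable

text \<open>A positive power is an order isomorphism whose inverse is the reciprocal power, so
  suprema pass through it without any continuity argument.\<close>

lemma ennreal_powr_SUP:
  assumes "0 < \<alpha>"
  shows "ennreal_powr (SUP n. f n) \<alpha> \<le> (SUP n. ennreal_powr (f n) \<alpha>)"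
proof -
  have "(SUP n. f n) \<le> ennreal_powr (SUP n. ennreal_powr (f n) \<alpha>) (1 / \<alpha>)"
  proof (rule SUP_least)
    fix n
    have "f n = ennreal_powr (ennreal_powr (f n) \<alpha>) (1 / \<alpha>)"
      using assms by (simp add: ennreal_powr_powr_inverse)
    also have "\<dots> \<le> ennreal_powr (SUP n. ennreal_powr (f n) \<alpha>) (1 / \<alpha>)"
      using assms by (intro ennreal_powr_mono SUP_upper) auto
    finally show "f n \<le> \<dots>" .
  qed
  from ennreal_powr_mono[OF this, of \<alpha>] assms show ?thesis
    by (simp add: ennreal_powr_powr_inverse)
qed

text \<open>Convexity of the p-th power, applied to a / X and b / Y with the weights X / (X + Y) and
  Y / (X + Y). With X and Y bounding the norms of two functions, integration of this inequality
  yields Minkowski's inequality.\<close>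

lemma powr_add_le:
  fixes a b X Y p :: real
  assumes "1 \<le> p" "0 \<le> a" "0 \<le> b" "0 < X" "0 < Y"
  shows "(a + b) powr p \<le> (X + Y) powr (p - 1) * (X powr (1 - p) * a powr p + Y powr (1 - p) * b powr p)"
proof -
  define t where "t = X / (X + Y)"
  have t: "0 < t" "t < 1" "1 - t = Y / (X + Y)"
    using assms by (auto simp: t_def field_simps)
  have tX: "t * (a / X) = a / (X + Y)" "(1 - t) * (b / Y) = b / (X + Y)"
    using assms unfolding t(3) by (auto simp: t_def)
  \<comment> \<open>Convexity is invoked for positive arguments only; when x or y is zero, the claim
    reduces to u^p \<le> u for a weight u in (0, 1).\<close>
  have conv: "(t * x + (1 - t) * y) powr p \<le> t * x powr p + (1 - t) * y powr p"
    if xy: "0 \<le> x" "0 \<le> y" for x y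
  proof -
    consider "x = 0" | "y = 0" | "0 < x" "0 < y" using xy by linarith
    then show ?thesis
    proof cases
      case 1
      have "(1 - t) powr p \<le> (1 - t) powr 1"
        using t assms by (intro powr_mono') auto
      from mult_right_mono[OF this, of "y powr p"] show ?thesis
        using 1 t(1,2) assms(1) xy by (simp add: powr_mult)
    next
      case 2
      have "t powr p \<le> t powr 1"
        using t assms by (intro powr_mono') auto
      from mult_right_mono[OF this, of "x powr p"] show ?thesis
        using 2 t(1,2) assms(1) xy by (simp add: powr_mult)
    next
      case 3
      then show ?thesis
        using convex_onD[OF powr_convex[OF assms(1)], of "1 - t" x y] t(1,2) by (simp add: add.commute)
    qed
  qed
  have "((a + b) / (X + Y)) powr p = (t * (a / X) + (1 - t) * (b / Y)) powr p"
    unfolding tX by (simp add: add_divide_distrib)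
  also have "\<dots> \<le> t * (a / X) powr p + (1 - t) * (b / Y) powr p"
    using assms by (intro conv) auto
  finally have "(X + Y) powr p * ((a + b) / (X + Y)) powr p \<le>
      (X + Y) powr p * (t * (a / X) powr p + (1 - t) * (b / Y) powr p)"
    by (intro mult_left_mono) auto
  moreover have "(X + Y) powr p * ((a + b) / (X + Y)) powr p = (a + b) powr p"
    using assms by (simp add: powr_divide)
  moreover have "(X + Y) powr p * (t * (a / X) powr p + (1 - t) * (b / Y) powr p) =
      (X + Y) powr (p - 1) * (X powr (1 - p) * a powr p + Y powr (1 - p) * b powr p)"
  proof -
    have "(X + Y) powr p * (t * (a / X) powr p) = (X + Y) powr (p - 1) * (X powr (1 - p) * a powr p)"
      using assms by (simp add: t_def powr_divide powr_diff)
    moreover have "(X + Y) powr p * ((1 - t) * (b / Y) powr p) =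
        (X + Y) powr (p - 1) * (Y powr (1 - p) * b powr p)"
      using assms unfolding t(3) by (simp add: powr_divide powr_diff)
    ultimately show ?thesis by (simp only: distrib_left)
  qed
  ultimately show ?thesis by simp
qed

text \<open>The functional that \<open>besov_seminorm\<close> applies to the weighted modulus, for
  an arbitrary integrand: the norm of L^p with respect to the Haar measure dh / h of the
  multiplicative group of positive reals. For p = \<infinity> it is the actual, not the essential,
  supremum.\<close>

definition haar_Lp :: "ennreal \<Rightarrow> (real \<Rightarrow> ennreal) \<Rightarrow> ennreal" where
  "haar_Lp p f = (if p = \<infinity> then (SUP h\<in>{0<..}. f h)
     else ennreal_powr
            (\<integral>\<^sup>+h\<in>{0<..}. (ennreal_powr (f h) (enn2real p) * ennreal (1 / h)) \<partial>lborel)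
            (1 / enn2real p))"

lemma enn2real_ge_one:
  assumes "(1::ennreal) \<le> p" "p \<noteq> \<infinity>"
  shows "1 \<le> enn2real p"
  using assms by (cases p) (auto simp: ennreal_1[symmetric] simp del: ennreal_1)

lemma haar_Lp_mono:
  assumes "\<And>h. 0 < h \<Longrightarrow> f h \<le> g h"
  shows "haar_Lp p f \<le> haar_Lp p g"
proof (cases "p = \<infinity>")
  case True
  then show ?thesis using assms by (auto simp: haar_Lp_def intro!: SUP_subset_mono)
next
  case False
  have "ennreal_powr (f h) P * ennreal (1 / h) * indicator {0<..} h \<le>
      ennreal_powr (g h) P * ennreal (1 / h) * indicator {0<..} h" if "0 \<le> P" for h P
    using that assms[of h] by (auto simp: indicator_def intro!: mult_right_mono ennreal_powr_mono)
  then show ?thesis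
    using False by (auto simp: haar_Lp_def intro!: ennreal_powr_mono nn_integral_mono)
qed

lemma haar_Lp_cmult:
  assumes [measurable]: "f \<in> borel_measurable borel" and "1 \<le> p"
  shows "haar_Lp p (\<lambda>h. c * f h) = c * haar_Lp p f"
proof (cases "p = \<infinity>")
  case True
  then show ?thesis
    by (simp add: haar_Lp_def SUP_mult_left_ennreal)
next
  case False
  define P where "P = enn2real p"
  have P: "1 \<le> P" using False assms enn2real_ge_one by (auto simp: P_def)
  have "(\<integral>\<^sup>+h\<in>{0<..}. (ennreal_powr (c * f h) P * ennreal (1 / h)) \<partial>lborel)
      = (\<integral>\<^sup>+h. ennreal_powr c P * (ennreal_powr (f h) P * ennreal (1 / h) * indicator {0<..} h) \<partial>lborel)"
    using P by (simp add: ennreal_powr_mult mult.assoc)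
  also have "\<dots> = ennreal_powr c P * (\<integral>\<^sup>+h\<in>{0<..}. (ennreal_powr (f h) P * ennreal (1 / h)) \<partial>lborel)"
    by (rule nn_integral_cmult) measurable
  finally show ?thesis
    using False P
    by (simp add: haar_Lp_def P_def[symmetric] ennreal_powr_mult ennreal_powr_powr_inverse)
qed

text \<open>Dilation invariance of dh / h: the Jacobian c of the substitution cancels the c in 1 /
  (c h). This is what makes estimates at all dyadic scales cost the same.\<close>

lemma haar_Lp_scale:
  assumes [measurable]: "f \<in> borel_measurable borel" and "0 < c"
  shows "haar_Lp p (\<lambda>h. f (c * h)) \<le> haar_Lp p f"
proof (cases "p = \<infinity>")
  case True
  then show ?thesis using assms
    by (auto simp: haar_Lp_def intro!: SUP_least SUP_upper)
next
  case False
  define P where "P = enn2real p"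
  have "(\<integral>\<^sup>+h\<in>{0<..}. (ennreal_powr (f h) P * ennreal (1 / h)) \<partial>lborel) =
    ennreal \<bar>c\<bar> * (\<integral>\<^sup>+h. (ennreal_powr (f (0 + c * h)) P * ennreal (1 / (0 + c * h)) * indicator {0<..} (0 + c * h)) \<partial>lborel)"
    using assms by (intro nn_integral_real_affine) auto
  also have "\<dots> = (\<integral>\<^sup>+h. ennreal c * (ennreal_powr (f (c * h)) P * ennreal (1 / (c * h)) * indicator {0<..} (c * h)) \<partial>lborel)"
    using assms by (subst nn_integral_cmult) auto
  also have "\<dots> = (\<integral>\<^sup>+h\<in>{0<..}. (ennreal_powr (f (c * h)) P * ennreal (1 / h)) \<partial>lborel)"
  proof (intro nn_integral_cong)
    fix h :: real
    show "ennreal c * (ennreal_powr (f (c * h)) P * ennreal (1 / (c * h)) * indicator {0<..} (c * h)) =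
      ennreal_powr (f (c * h)) P * ennreal (1 / h) * indicator {0<..} h"
    proof (cases "0 < h")
      case True
      then have "ennreal (1 / h) = ennreal c * ennreal (1 / (c * h))"
        using assms by (simp flip: ennreal_mult)
      then show ?thesis using True assms by (simp add: mult_ac)
    qed (use assms in \<open>auto simp: zero_less_mult_iff\<close>)
  qed
  finally show ?thesis using False by (simp add: haar_Lp_def P_def[symmetric])
qed

text \<open>Minkowski's inequality. For finite p it comes from integrating
  \<open>powr_add_le\<close>, where X and Y are any strictly positive upper bounds of the two
  norms.\<close>

lemma haar_Lp_add:
  assumes [measurable]: "f \<in> borel_measurable borel" "g \<in> borel_measurable borel" and "1 \<le> p"
  shows "haar_Lp p (\<lambda>h. f h + g h) \<le> haar_Lp p f + haar_Lp p g"
proof (cases "p = \<infinity>")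
  case True
  then show ?thesis
    by (auto simp: haar_Lp_def intro!: SUP_least add_mono SUP_upper)
next
  case False
  define P where "P = enn2real p"
  have P: "1 \<le> P" using False assms enn2real_ge_one by (auto simp: P_def)
  define I where "I f = (\<integral>\<^sup>+h\<in>{0<..}. (ennreal_powr (f h) P * ennreal (1 / h)) \<partial>lborel)" for f
  have LI: "haar_Lp p f \<le> ennreal X \<longleftrightarrow> I f \<le> ennreal (X powr P)" if "0 \<le> X" for f X
    using False P that ennreal_powr_le_iff[of P "I f" "ennreal X"]
    by (simp add: haar_Lp_def I_def P_def[symmetric] ennreal_powr_ennreal max_def)
  have main: "haar_Lp p (\<lambda>h. f h + g h) \<le> ennreal (X + Y)"
    if XY: "0 < X" "0 < Y" and f: "haar_Lp p f \<le> ennreal X" and g: "haar_Lp p g \<le> ennreal Y" for X Y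
  proof -
    define A where "A = (X + Y) powr (P - 1) * X powr (1 - P)"
    define B where "B = (X + Y) powr (P - 1) * Y powr (1 - P)"
    have AB: "0 < A" "0 < B" using XY by (auto simp: A_def B_def)
    have pt: "ennreal_powr (x + y) P \<le> ennreal A * ennreal_powr x P + ennreal B * ennreal_powr y P" for x y
    proof (cases "x = \<infinity> \<or> y = \<infinity>")
      case True
      then show ?thesis using AB by (auto simp: ennreal_powr_def ennreal_mult_top)
    next
      case False
      then obtain a b where ab: "x = ennreal a" "y = ennreal b" "0 \<le> a" "0 \<le> b"
        by (metis ennreal_cases infinity_ennreal_def)
      have "(a + b) powr P \<le> A * a powr P + B * b powr P"
        using powr_add_le[OF P ab(3,4) XY] by (simp add: A_def B_def distrib_left mult_ac)
      then have "ennreal ((a + b) powr P) \<le> ennreal (A * a powr P + B * b powr P)"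
        by (rule ennreal_leI)
      also have "\<dots> = ennreal A * ennreal (a powr P) + ennreal B * ennreal (b powr P)"
        using AB by (simp add: ennreal_mult')
      finally show ?thesis using ab AB by (simp add: ennreal_powr_ennreal flip: ennreal_plus)
    qed
    have "I (\<lambda>h. f h + g h) \<le> (\<integral>\<^sup>+h. ennreal A * (ennreal_powr (f h) P * ennreal (1 / h) * indicator {0<..} h)
        + ennreal B * (ennreal_powr (g h) P * ennreal (1 / h) * indicator {0<..} h) \<partial>lborel)"
      unfolding I_def
    proof (intro nn_integral_mono)
      fix h :: real
      show "ennreal_powr (f h + g h) P * ennreal (1 / h) * indicator {0<..} h \<le>
        ennreal A * (ennreal_powr (f h) P * ennreal (1 / h) * indicator {0<..} h)
        + ennreal B * (ennreal_powr (g h) P * ennreal (1 / h) * indicator {0<..} h)"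
        using mult_right_mono[OF pt[of "f h" "g h"], of "ennreal (1 / h) * indicator {0<..} h"]
        by (simp add: mult.assoc distrib_right)
    qed
    also have "\<dots> = ennreal A * I f + ennreal B * I g"
      unfolding I_def by (subst nn_integral_add) (auto simp: nn_integral_cmult)
    also have "\<dots> \<le> ennreal A * ennreal (X powr P) + ennreal B * ennreal (Y powr P)"
      using f g XY LI by (intro add_mono mult_left_mono) auto
    also have "\<dots> = ennreal (A * X powr P + B * Y powr P)"
      using AB by (simp add: ennreal_mult')
    \<comment> \<open>The weights A and B are chosen so that the integrated bound is exactly (X +
      Y)^P.\<close>
    also have "A * X powr P + B * Y powr P = (X + Y) powr P"
    proof -
      have "X powr (1 - P) * X powr P = X" "Y powr (1 - P) * Y powr P = Y"
        using XY by (simp_all flip: powr_add)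
      then have "A * X powr P + B * Y powr P = (X + Y) powr (P - 1) * (X + Y) powr 1"
        using XY by (simp add: A_def B_def mult.assoc distrib_left)
      also have "\<dots> = (X + Y) powr P" unfolding powr_add[symmetric] by simp
      finally show ?thesis .
    qed
    finally show ?thesis using LI[of "X + Y"] XY by auto
  qed
  show ?thesis
  proof (rule ennreal_le_epsilon)
    fix e :: real
    assume fin: "haar_Lp p f + haar_Lp p g < top" and e: "0 < e"
    then obtain x y where xy: "haar_Lp p f = ennreal x" "haar_Lp p g = ennreal y" "0 \<le> x" "0 \<le> y"
      by (metis ennreal_add_eq_top ennreal_cases less_irrefl)
    \<comment> \<open>Since a norm may vanish while \<open>main\<close> needs strictly positive
      bounds, half of e is added to each.\<close>
    have "haar_Lp p (\<lambda>h. f h + g h) \<le> ennreal ((x + e / 2) + (y + e / 2))"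
      using xy e by (intro main) (auto intro!: ennreal_leI)
    then show "haar_Lp p (\<lambda>h. f h + g h) \<le> haar_Lp p f + haar_Lp p g + ennreal e"
      using xy e by (simp add: add_ac flip: ennreal_plus)
  qed
qed

lemma haar_Lp_zero: "1 \<le> p \<Longrightarrow> haar_Lp p (\<lambda>h. 0) = 0"
  by (auto simp: haar_Lp_def ennreal_powr_def zero_less_one)

lemma haar_Lp_sum:
  assumes "\<And>j. f j \<in> borel_measurable borel" and "1 \<le> p"
  shows "haar_Lp p (\<lambda>h. \<Sum>j<(n::nat). f j h) \<le> (\<Sum>j<n. haar_Lp p (f j))"
proof (induction n)
  case 0
  then show ?case using assms by (simp add: haar_Lp_zero)
next
  case (Suc n)
  have "haar_Lp p (\<lambda>h. \<Sum>j<Suc n. f j h) \<le> haar_Lp p (\<lambda>h. \<Sum>j<n. f j h) + haar_Lp p (f n)"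
    using haar_Lp_add[of "\<lambda>h. \<Sum>j<n. f j h" "f n" p] assms by simp
  then show ?case using Suc by (simp add: order_trans add_right_mono)
qed

lemma haar_Lp_SUP:
  fixes f :: "nat \<Rightarrow> real \<Rightarrow> ennreal"
  assumes [measurable]: "\<And>j. f j \<in> borel_measurable borel" and "incseq f" and "1 \<le> p"
  shows "haar_Lp p (\<lambda>h. SUP n. f n h) \<le> (SUP n. haar_Lp p (f n))"
proof (cases "p = \<infinity>")
  case True
  then show ?thesis
    unfolding haar_Lp_def by (simp only: if_True simp_thms) (subst SUP_commute, rule order_refl)
next
  case False
  define P where "P = enn2real p"
  have P: "1 \<le> P" using False assms enn2real_ge_one by (auto simp: P_def)
  define I where "I f = (\<integral>\<^sup>+h\<in>{0<..}. (ennreal_powr (f h) P * ennreal (1 / h)) \<partial>lborel)" for f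
  have LI: "haar_Lp p f \<le> X \<longleftrightarrow> I f \<le> ennreal_powr X P" for f X
    using False P ennreal_powr_le_iff[of P "I f" X]
    by (simp add: haar_Lp_def I_def P_def[symmetric])
  have "I (\<lambda>h. SUP n. f n h) \<le> (\<integral>\<^sup>+h. (SUP n. ennreal_powr (f n h) P * ennreal (1 / h) * indicator {0<..} h) \<partial>lborel)"
    unfolding I_def
  proof (intro nn_integral_mono)
    fix h :: real
    have "ennreal_powr (SUP n. f n h) P * ennreal (1 / h) * indicator {0<..} h \<le>
        (SUP n. ennreal_powr (f n h) P) * (ennreal (1 / h) * indicator {0<..} h)"
      unfolding mult.assoc using P by (intro mult_right_mono ennreal_powr_SUP) auto
    then show "ennreal_powr (SUP n. f n h) P * ennreal (1 / h) * indicator {0<..} h \<le>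
        (SUP n. ennreal_powr (f n h) P * ennreal (1 / h) * indicator {0<..} h)"
      by (simp add: SUP_mult_right_ennreal mult.assoc)
  qed
  also have "\<dots> = (SUP n. I (f n))"
    unfolding I_def using P assms(2)
    by (intro nn_integral_monotone_convergence_SUP)
       (auto simp: incseq_def le_fun_def intro!: mult_right_mono ennreal_powr_mono)
  also have "\<dots> \<le> ennreal_powr (SUP n. haar_Lp p (f n)) P"
    by (intro SUP_least, subst LI[symmetric]) (auto intro: SUP_upper)
  finally show ?thesis by (simp add: LI)
qed

text \<open>Finite subadditivity for the partial sums, followed by monotone convergence.\<close>

lemma haar_Lp_suminf:
  assumes [measurable]: "\<And>j. f j \<in> borel_measurable borel" and "1 \<le> p"
  shows "haar_Lp p (\<lambda>h. \<Sum>j. f j h) \<le> (\<Sum>j. haar_Lp p (f j))"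
proof -
  have "haar_Lp p (\<lambda>h. SUP n. \<Sum>j<n. f j h) \<le> (SUP n. haar_Lp p (\<lambda>h. \<Sum>j<n. f j h))"
    using assms by (intro haar_Lp_SUP) (auto simp: incseq_def le_fun_def intro!: sum_mono2)
  also have "\<dots> \<le> (SUP n. \<Sum>j<n. haar_Lp p (f j))"
    using assms by (intro SUP_mono' haar_Lp_sum)
  finally show ?thesis by (simp add: suminf_eq_SUP)
qed

text \<open>A dyadic interval has dh / h measure log 2, which lies between 1/2 and 1. The crude
  bounds hold uniformly in x and p.\<close>

lemma haar_Lp_indicator_dyadic:
  assumes "0 < x" "1 \<le> p"
  shows "haar_Lp p (indicator {x..<2 * x}) \<le> 1" "ennreal (1 / 2) \<le> haar_Lp p (indicator {x..<2 * x})"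
proof -
  have ind: "ennreal_powr (indicator A h) \<alpha> = indicator A h" if "0 < \<alpha>" for A h \<alpha>
    using that by (auto simp: ennreal_powr_def split: split_indicator)
  have I: "(\<integral>\<^sup>+h. ennreal c * indicator {x..<2 * x} h \<partial>lborel) = ennreal (c * x)" if "0 \<le> c" for c
    using assms that by (simp add: nn_integral_cmult ennreal_mult)
  have "haar_Lp p (indicator {x..<2 * x}) \<le> 1 \<and> ennreal (1 / 2) \<le> haar_Lp p (indicator {x..<2 * x})"
  proof (cases "p = \<infinity>")
    case True
    have "(indicator {x..<2 * x} x :: ennreal) = 1" using assms by simp
    then have "1 \<le> (SUP h\<in>{0<..}. indicator {x..<2 * x} h :: ennreal)"
      using assms by (intro SUP_upper2[of x]) auto
    moreover have "ennreal (1 / 2) \<le> 1"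
      using ennreal_leI[of "1 / 2" 1] unfolding ennreal_1 by simp
    ultimately show ?thesis using True
      by (auto simp: haar_Lp_def intro!: SUP_least split: split_indicator elim: order_trans)
  next
    case False
    define P where "P = enn2real p"
    have P: "1 \<le> P" using False assms enn2real_ge_one by (auto simp: P_def)
    define I where "I = (\<integral>\<^sup>+h\<in>{0<..}. (indicator {x..<2 * x} h * ennreal (1 / h)) \<partial>lborel)"
    have L: "haar_Lp p (indicator {x..<2 * x}) = ennreal_powr I (1 / P)"
      using False P by (simp add: haar_Lp_def P_def[symmetric] ind I_def)
    have "I \<le> (\<integral>\<^sup>+h. ennreal (1 / x) * indicator {x..<2 * x} h \<partial>lborel)"
      unfolding I_def using assms
      by (intro nn_integral_mono) (auto split: split_indicator intro!: ennreal_leI simp: field_simps)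
    also have "\<dots> = 1" using assms by (simp add: I)
    finally have "ennreal_powr I (1 / P) \<le> ennreal_powr 1 (1 / P)"
      using P by (intro ennreal_powr_mono) auto
    moreover have "ennreal (1 / 2) \<le> I"
    proof -
      have "ennreal (1 / 2) = (\<integral>\<^sup>+h. ennreal (1 / (2 * x)) * indicator {x..<2 * x} h \<partial>lborel)"
        using assms by (simp add: I)
      also have "\<dots> \<le> I"
        unfolding I_def using assms
        by (intro nn_integral_mono) (auto split: split_indicator intro!: ennreal_leI simp: field_simps)
      finally show ?thesis .
    qed
    then have "ennreal_powr (ennreal (1 / 2)) (1 / P) \<le> ennreal_powr I (1 / P)"
      using P by (intro ennreal_powr_mono) auto
    \<comment> \<open>Taking a root of exponent 1 / P \<le> 1 does not decrease a number in (0,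
      1).\<close>
    moreover have "ennreal (1 / 2) \<le> ennreal_powr (ennreal (1 / 2)) (1 / P)"
      using P powr_mono'[of "1 / P" 1 "1 / 2 :: real"]
      unfolding ennreal_powr_ennreal by (intro ennreal_leI) auto
    ultimately show ?thesis unfolding L by (auto simp: ennreal_powr_def)
  qed
  then show "haar_Lp p (indicator {x..<2 * x}) \<le> 1" "ennreal (1 / 2) \<le> haar_Lp p (indicator {x..<2 * x})"
    by auto
qed

section \<open>Geometric series and recursive inequalities\<close>

lemma suminf_ennreal_geometric:
  assumes "0 \<le> \<theta>" "\<theta> < 1"
  shows "(\<Sum>j. ennreal \<theta> ^ j) = ennreal (1 / (1 - \<theta>))"
proof -
  have "(\<Sum>j. ennreal (\<theta> ^ j)) = ennreal (\<Sum>j. \<theta> ^ j)"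
    using assms by (intro suminf_ennreal2 summable_geometric) auto
  then show ?thesis using assms by (simp add: ennreal_power suminf_geometric)
qed

text \<open>By dilation invariance every summand costs only its weight, whatever the dilation
  factors are. All passages from pointwise dyadic estimates to Besov seminorms use this
  form.\<close>

lemma haar_Lp_geometric:
  assumes [measurable]: "f \<in> borel_measurable borel"
    and "\<And>j. 0 < \<gamma> j" "0 \<le> \<theta>" "\<theta> < 1" "1 \<le> p"
  shows "haar_Lp p (\<lambda>h. \<Sum>j. ennreal \<theta> ^ j * f (\<gamma> j * h)) \<le> ennreal (1 / (1 - \<theta>)) * haar_Lp p f"
proof -
  have "haar_Lp p (\<lambda>h. \<Sum>j. ennreal \<theta> ^ j * f (\<gamma> j * h)) \<le>
      (\<Sum>j. haar_Lp p (\<lambda>h. ennreal \<theta> ^ j * f (\<gamma> j * h)))"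
    using assms by (intro haar_Lp_suminf) auto
  also have "\<dots> \<le> (\<Sum>j. ennreal \<theta> ^ j * haar_Lp p f)"
    using assms by (intro suminf_le) (auto simp: haar_Lp_cmult intro!: mult_left_mono haar_Lp_scale)
  finally show ?thesis using assms by (simp add: suminf_ennreal_geometric)
qed

text \<open>Unrolling the recursion J times leaves the remainder \<theta>^J times x at J, which
  tends to zero because x is bounded by the finite B.\<close>

lemma ennreal_le_geometric_sum:
  fixes x y :: "nat \<Rightarrow> ennreal"
  assumes step: "\<And>j. x j \<le> y j + ennreal \<theta> * x (Suc j)" and bound: "\<And>j. x j \<le> B" "B < top"
    and \<theta>: "0 \<le> \<theta>" "\<theta> < 1"
  shows "x 0 \<le> (\<Sum>j. ennreal \<theta> ^ j * y j)"
proof -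
  obtain b where b: "B = ennreal b" "0 \<le> b" using bound(2) by (cases B) auto
  have fin: "x 0 \<le> (\<Sum>j<J. ennreal \<theta> ^ j * y j) + ennreal \<theta> ^ J * x J" for J
  proof (induction J)
    case (Suc J)
    note Suc
    also have "(\<Sum>j<J. ennreal \<theta> ^ j * y j) + ennreal \<theta> ^ J * x J \<le>
        (\<Sum>j<J. ennreal \<theta> ^ j * y j) + ennreal \<theta> ^ J * (y J + ennreal \<theta> * x (Suc J))"
      by (intro add_left_mono mult_left_mono step) auto
    finally show ?case by (simp add: distrib_left mult_ac add_ac)
  qed simp
  have le: "x 0 \<le> (\<Sum>j. ennreal \<theta> ^ j * y j) + ennreal (\<theta> ^ J * b)" for J
  proof -
    note fin[of J]
    also have "(\<Sum>j<J. ennreal \<theta> ^ j * y j) + ennreal \<theta> ^ J * x J \<le>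
        (\<Sum>j. ennreal \<theta> ^ j * y j) + ennreal \<theta> ^ J * B"
      by (intro add_mono mult_left_mono bound sum_le_suminf) auto
    also have "ennreal \<theta> ^ J * B = ennreal (\<theta> ^ J * b)"
      unfolding b(1) ennreal_power[OF \<theta>(1)] using \<theta> b by (simp add: ennreal_mult)
    finally show ?thesis .
  qed
  have "(\<lambda>J. (\<Sum>j. ennreal \<theta> ^ j * y j) + ennreal (\<theta> ^ J * b)) \<longlonglongrightarrow>
      (\<Sum>j. ennreal \<theta> ^ j * y j) + ennreal (0 * b)"
    using \<theta> by (intro tendsto_add tendsto_const tendsto_ennrealI tendsto_mult LIMSEQ_power_zero) auto
  then have "x 0 \<le> (\<Sum>j. ennreal \<theta> ^ j * y j) + ennreal (0 * b)"
    by (rule LIMSEQ_le_const) (use le in blast)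
  then show ?thesis by simp
qed

text \<open>Here the recursion runs towards larger indices, so the partial sums can be bounded by
  induction. Nothing is subtracted, hence infinite values do no harm.\<close>

lemma ennreal_suminf_absorb:
  fixes x y :: "nat \<Rightarrow> ennreal"
  assumes step: "\<And>n. x (Suc n) \<le> y n + ennreal \<theta> * x n" and \<theta>: "0 \<le> \<theta>" "\<theta> < 1"
  shows "(\<Sum>n. x n) \<le> ennreal (1 / (1 - \<theta>)) * (x 0 + (\<Sum>n. y n))"
proof -
  define e where "e = ennreal (1 / (1 - \<theta>))"
  define Z where "Z = x 0 + (\<Sum>n. y n)"
  \<comment> \<open>The constant is the fixed point of e \<mapsto> 1 + \<theta> e, which is what the
    induction on partial sums reproduces.\<close>
  have e: "1 + ennreal \<theta> * e = e"
  proof -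
    have "1 + ennreal \<theta> * e = ennreal (1 + \<theta> * (1 / (1 - \<theta>)))"
      using \<theta> by (simp add: e_def flip: ennreal_mult)
    also have "1 + \<theta> * (1 / (1 - \<theta>)) = 1 / (1 - \<theta>)" using \<theta> by (simp add: field_simps)
    finally show ?thesis by (simp add: e_def)
  qed
  have "(\<Sum>n<J. x n) \<le> e * Z" for J
  proof (induction J)
    case (Suc J)
    have "(\<Sum>n<Suc J. x n) = x 0 + (\<Sum>n<J. x (Suc n))"
      by (rule sum.lessThan_Suc_shift)
    also have "\<dots> \<le> x 0 + (\<Sum>n<J. y n + ennreal \<theta> * x n)"
      by (intro add_left_mono sum_mono step)
    also have "\<dots> = x 0 + (\<Sum>n<J. y n) + ennreal \<theta> * (\<Sum>n<J. x n)"
      by (simp add: sum.distrib sum_distrib_left add_ac)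
    also have "\<dots> \<le> Z + ennreal \<theta> * (e * Z)"
      unfolding Z_def by (intro add_mono mult_left_mono sum_le_suminf Suc[unfolded Z_def]) auto
      also have "\<dots> = (1 + ennreal \<theta> * e) * Z" by (simp only: distrib_right mult_1_left mult.assoc)
    finally show ?case by (simp add: e)
  qed simp
  then show ?thesis unfolding e_def Z_def by (intro suminf_le_const) auto
qed

section \<open>Moduli of smoothness and Marchaud's inequality\<close>

locale linear_flow =
  fixes \<psi> :: "real ^ 'd \<Rightarrow> 'a::real_vector \<Rightarrow> 'a"
  assumes linear_flow: "linear (\<psi> t)"
    and flow_add: "\<psi> s (\<psi> t x) = \<psi> (s + t) x"
begin

abbreviation D :: "real ^ 'd \<Rightarrow> 'a \<Rightarrow> 'a" where "D \<equiv> group_difference \<psi>"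

lemma linear_D: "linear (D t)"
  unfolding group_difference_def by (intro linear_compose_sub linear_flow linear_id[unfolded id_def])

lemma linear_funpow: "linear f \<Longrightarrow> linear ((f ^^ k) :: 'a \<Rightarrow> 'a)"
  by (induction k) (auto simp: linear_id intro: linear_compose)

lemmas D_simps = linear_add[OF linear_D] linear_diff[OF linear_D] linear_scale[OF linear_D]
lemmas Dpow_simps = linear_add[OF linear_funpow[OF linear_D]] linear_diff[OF linear_funpow[OF linear_D]]
  linear_scale[OF linear_funpow[OF linear_D]]

lemma flow_D: "\<psi> s (D t x) = D t (\<psi> s x)"
  by (simp add: group_difference_def linear_diff[OF linear_flow] flow_add add.commute)

lemma flow_Dpow: "\<psi> s ((D t ^^ k) x) = (D t ^^ k) (\<psi> s x)"
  by (induction k) (auto simp: flow_D)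

lemma D_Dpow: "D s ((D t ^^ k) x) = (D t ^^ k) (D s x)"
  by (simp add: group_difference_def[of \<psi> s] flow_Dpow Dpow_simps)

lemma Dpow_Dpow: "(D s ^^ j) ((D t ^^ k) x) = (D t ^^ k) ((D s ^^ j) x)"
  by (induction j) (auto simp: D_Dpow)

lemma D_double: "D (t + t) x = \<psi> t (D t x) + D t x"
  by (simp add: group_difference_def linear_diff[OF linear_flow] flow_add)

text \<open>With T = \<open>\<psi> t\<close>, the factorization T^2 - 1 = (T + 1) (T - 1) has
  commuting factors, so its k-th power may be taken factor by factor.\<close>

lemma Dpow_double: "(D (t + t) ^^ k) x = ((\<lambda>y. \<psi> t y + y) ^^ k) ((D t ^^ k) x)"
proof (induction k)
  case (Suc k)
  have comm: "D t (((\<lambda>y. \<psi> t y + y) ^^ k) y) = ((\<lambda>y. \<psi> t y + y) ^^ k) (D t y)" for y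
    by (induction k) (simp_all add: D_simps flip: flow_D)
  have "(D (t + t) ^^ Suc k) x = D (t + t) (((\<lambda>y. \<psi> t y + y) ^^ k) ((D t ^^ k) x))"
    unfolding funpow.simps comp_def Suc ..
  also have "\<dots> = ((\<lambda>y. \<psi> t y + y) ^^ Suc k) ((D t ^^ Suc k) x)"
    unfolding D_double by (simp add: comm)
  finally show ?case .
qed simp

end

lemma sum_abs_double_le:
  assumes "(\<Sum>j\<in>UNIV. \<bar>t $ j\<bar>) \<le> (h::real)"
  shows "(\<Sum>j\<in>UNIV. \<bar>(t + t) $ j\<bar>) \<le> 2 * h"
proof -
  have "(\<Sum>j\<in>UNIV. \<bar>(t + t) $ j\<bar>) = (\<Sum>j\<in>UNIV. 2 * \<bar>t $ j\<bar>)"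
    by (intro sum.cong) auto
  also have "\<dots> = 2 * (\<Sum>j\<in>UNIV. \<bar>t $ j\<bar>)" by (simp add: sum_distrib_left)
  finally show ?thesis using assms by simp
qed

text \<open>Superlevel sets of a monotone function are intervals. Moduli of smoothness are monotone
  in h, so they are measurable in h even when the orbits of the group are not measurable.\<close>

lemma borel_measurable_mono_ennreal:
  fixes f :: "real \<Rightarrow> ennreal"
  assumes "mono f"
  shows "f \<in> borel_measurable borel"
proof (rule borel_measurableI_greater)
  fix y
  have "is_interval {x. y < f x}"
    unfolding is_interval_1 using assms by (auto dest: monoD elim: less_le_trans)
  then show "{x \<in> space borel. y < f x} \<in> sets borel"
    by (auto intro: real_interval_borel_measurable)
qed

text \<open>The norm may be infinite, with the same conventions as for the encoding of Besov spaces.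
  Thus the algebra norm and the Besov norms built on it are instances for one and the same flow, and
  every result proved here can be used at both levels.\<close>

locale flow_norm = linear_flow \<psi> for \<psi> :: "real ^ 'd \<Rightarrow> 'a::real_vector \<Rightarrow> 'a" +
  fixes N :: "'a \<Rightarrow> ennreal" and K :: ennreal
  assumes K_finite: "K < top"
    and norm_add: "N (x + y) \<le> N x + N y"
    and norm_scale: "N (c *\<^sub>R x) \<le> ennreal \<bar>c\<bar> * N x"
    and norm_flow: "N (\<psi> t x) \<le> K * N x"
begin

abbreviation \<omega> :: "nat \<Rightarrow> real \<Rightarrow> 'a \<Rightarrow> ennreal" where
  "\<omega> \<equiv> smoothness_modulus \<psi> N"

text \<open>The integrand of the Besov seminorm. The order k is independent of the smoothness r,
  since the proof keeps changing the order.\<close>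

definition W :: "real \<Rightarrow> nat \<Rightarrow> 'a \<Rightarrow> real \<Rightarrow> ennreal" where
  "W r k x h = ennreal (h powr (- r)) * \<omega> k h x"

lemma K1_finite: "(K + 1) ^ k < top"
  using K_finite by (simp add: power_less_top_ennreal)

lemma norm_diff: "N (x - y) \<le> N x + N y"
  using norm_add[of x "- y"] norm_scale[of "-1" y] by (simp add: add_left_mono order_trans)

lemma norm_D: "N (D t x) \<le> (K + 1) * N x"
proof -
  have "N (D t x) \<le> N (\<psi> t x) + N x"
    unfolding group_difference_def by (rule norm_diff)
  also have "\<dots> \<le> K * N x + N x" by (intro add_right_mono norm_flow)
  finally show ?thesis by (simp add: distrib_right)
qed

lemma norm_Dpow: "N ((D t ^^ k) x) \<le> (K + 1) ^ k * N x"
proof (induction k)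
  case (Suc k)
  have "N ((D t ^^ Suc k) x) \<le> (K + 1) * N ((D t ^^ k) x)" by (simp add: norm_D)
  also have "\<dots> \<le> (K + 1) * ((K + 1) ^ k * N x)" by (intro mult_left_mono Suc) auto
  finally show ?case by (simp add: mult.assoc)
qed simp

lemma modulus_upper: "(\<Sum>j\<in>UNIV. \<bar>t $ j\<bar>) \<le> h \<Longrightarrow> N ((D t ^^ k) x) \<le> \<omega> k h x"
  unfolding smoothness_modulus_def by (rule SUP_upper) auto

lemma modulus_least:
  "(\<And>t. (\<Sum>j\<in>UNIV. \<bar>t $ j\<bar>) \<le> h \<Longrightarrow> N ((D t ^^ k) x) \<le> C) \<Longrightarrow> \<omega> k h x \<le> C"
  unfolding smoothness_modulus_def by (rule SUP_least) auto

lemma modulus_le: "\<omega> k h x \<le> (K + 1) ^ k * N x"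
  by (rule modulus_least) (rule norm_Dpow)

lemma modulus_mono: "h \<le> h' \<Longrightarrow> \<omega> k h x \<le> \<omega> k h' x"
  by (rule modulus_least) (rule modulus_upper, simp)

lemma measurable_modulus [measurable]: "(\<lambda>h. \<omega> k h x) \<in> borel_measurable borel"
  by (rule borel_measurable_mono_ennreal) (auto intro: monoI modulus_mono)

lemma measurable_W [measurable]: "W r k x \<in> borel_measurable borel"
  unfolding W_def[abs_def] by measurable

text \<open>Differences with different steps commute, so the power of \<open>D s\<close> can be
  pulled out and bounded by the operator bound K + 1.\<close>

lemma modulus_Dpow: "\<omega> k h ((D s ^^ j) x) \<le> (K + 1) ^ j * \<omega> k h x"
proof (rule modulus_least)
  fix t :: "real ^ 'd" assume t: "(\<Sum>j\<in>UNIV. \<bar>t $ j\<bar>) \<le> h"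
  have "N ((D t ^^ k) ((D s ^^ j) x)) = N ((D s ^^ j) ((D t ^^ k) x))" by (simp add: Dpow_Dpow)
  also have "\<dots> \<le> (K + 1) ^ j * N ((D t ^^ k) x)" by (rule norm_Dpow)
  also have "\<dots> \<le> (K + 1) ^ j * \<omega> k h x" by (intro mult_left_mono modulus_upper t) auto
  finally show "N ((D t ^^ k) ((D s ^^ j) x)) \<le> (K + 1) ^ j * \<omega> k h x" .
qed

lemma modulus_add_order: "\<omega> (j + k) h x \<le> (K + 1) ^ j * \<omega> k h x"
proof (rule modulus_least)
  fix t :: "real ^ 'd" assume t: "(\<Sum>j\<in>UNIV. \<bar>t $ j\<bar>) \<le> h"
  have "N ((D t ^^ (j + k)) x) \<le> (K + 1) ^ j * N ((D t ^^ k) x)"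
    unfolding funpow_add comp_def by (rule norm_Dpow)
  also have "\<dots> \<le> (K + 1) ^ j * \<omega> k h x" by (intro mult_left_mono modulus_upper t) auto
  finally show "N ((D t ^^ (j + k)) x) \<le> (K + 1) ^ j * \<omega> k h x" .
qed

text \<open>With \<open>T = \<psi> t\<close> and \<open>T\<^sup>2 - 1 = (T + 1) (T - 1)\<close>, the operator \<open>(T + 1)\<^sup>k\<close> differs from \<open>2\<^sup>k\<close> by a
  multiple of \<open>T - 1\<close>; this is the source of the leading constant \<open>2\<^sup>-\<^sup>k\<close> in Marchaud's inequality.\<close>

lemma flow_plus_id_pow:
  obtains C where "C < top"
    "\<And>t y. N (((\<lambda>y. \<psi> t y + y) ^^ k) y - (2 ^ k) *\<^sub>R y) \<le> C * N (D t y)"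
proof -
  have "\<exists>C<top. \<forall>t y. N (((\<lambda>y. \<psi> t y + y) ^^ k) y - (2 ^ k) *\<^sub>R y) \<le> C * N (D t y)"
  proof (induction k)
    case 0
    have "N 0 = 0" using norm_scale[of 0 0] by simp
    then show ?case by (intro exI[of _ 0]) auto
  next
    case (Suc k)
    then obtain C where C: "C < top"
      "\<And>t y. N (((\<lambda>y. \<psi> t y + y) ^^ k) y - (2 ^ k) *\<^sub>R y) \<le> C * N (D t y)" by blast
    have "N (((\<lambda>y. \<psi> t y + y) ^^ Suc k) y - (2 ^ Suc k) *\<^sub>R y) \<le> ((K + 1) * C + 2 ^ k) * N (D t y)" for t y
    proof -
      define z where "z = ((\<lambda>y. \<psi> t y + y) ^^ k) y - (2 ^ k) *\<^sub>R y"
      \<comment> \<open>With z the error at stage k, applying T + 1 to 2^k y + z gives 2^(k+1) y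
        plus the new errors (T + 1) z and 2^k (T - 1) y.\<close>
      have "((\<lambda>y. \<psi> t y + y) ^^ Suc k) y - (2 ^ Suc k) *\<^sub>R y = (\<psi> t z + z) + (2 ^ k) *\<^sub>R D t y"
        by (simp add: z_def group_difference_def linear_diff[OF linear_flow] linear_scale[OF linear_flow]
            algebra_simps flip: scaleR_2)
      also have "N \<dots> \<le> (N (\<psi> t z) + N z) + N ((2 ^ k) *\<^sub>R D t y)"
        by (intro order_trans[OF norm_add] add_right_mono norm_add)
      also have "\<dots> \<le> (K * N z + N z) + ennreal \<bar>2 ^ k\<bar> * N (D t y)"
        by (intro add_mono norm_flow norm_scale order_refl)
      also have "\<dots> = (K + 1) * N z + 2 ^ k * N (D t y)"
        by (simp add: distrib_right ennreal_power[symmetric])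
      also have "\<dots> \<le> (K + 1) * (C * N (D t y)) + 2 ^ k * N (D t y)"
        unfolding z_def by (intro add_right_mono mult_left_mono C) auto
      finally show ?thesis by (simp add: distrib_right mult.assoc)
    qed
    moreover have "(K + 1) * C + 2 ^ k < top"
      using C K_finite by (simp add: ennreal_mult_less_top power_less_top_ennreal)
    ultimately show ?case by blast
  qed
  then show ?thesis using that by blast
qed

text \<open>For y = (T - 1)^k x, the vector (T + 1)^k y is the k-th difference of x with doubled
  step and differs from 2^k y by at most a multiple of the next difference. Division by 2^k gives
  the small factor, which outweighs a weight 2^s whenever s < k.\<close>

lemma marchaud:
  obtains C where "C < top"
    "\<And>h x. \<omega> k h x \<le> C * \<omega> (Suc k) h x + ennreal ((1 / 2) ^ k) * \<omega> k (2 * h) x"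
proof -
  obtain C where C: "C < top"
    "\<And>t y. N (((\<lambda>y. \<psi> t y + y) ^^ k) y - (2 ^ k) *\<^sub>R y) \<le> C * N (D t y)"
    using flow_plus_id_pow[of k] by blast
  have "\<omega> k h x \<le> ennreal ((1 / 2) ^ k) * C * \<omega> (Suc k) h x + ennreal ((1 / 2) ^ k) * \<omega> k (2 * h) x" for h x
  proof (rule modulus_least)
    fix t :: "real ^ 'd" assume t: "(\<Sum>j\<in>UNIV. \<bar>t $ j\<bar>) \<le> h"
    define y where "y = (D t ^^ k) x"
    define z where "z = ((\<lambda>y. \<psi> t y + y) ^^ k) y"
    \<comment> \<open>Here z is the k-th difference of x with step t + t, and the inner bracket is
      the error controlled by \<open>flow_plus_id_pow\<close>.\<close>
    have "y = ((1 / 2) ^ k) *\<^sub>R (z - (z - (2 ^ k) *\<^sub>R y))"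
      by (simp flip: power_mult_distrib)
    then have "N y \<le> ennreal \<bar>(1 / 2) ^ k\<bar> * N (z - (z - (2 ^ k) *\<^sub>R y))"
      by (metis norm_scale)
    also have "\<dots> \<le> ennreal \<bar>(1 / 2) ^ k\<bar> * (N z + C * N (D t y))"
      unfolding z_def by (intro mult_left_mono order_trans[OF norm_diff] add_left_mono C) auto
    also have "\<dots> \<le> ennreal ((1 / 2) ^ k) * (\<omega> k (2 * h) x + C * \<omega> (Suc k) h x)"
    proof -
      have "N z \<le> \<omega> k (2 * h) x"
        using modulus_upper[OF sum_abs_double_le[OF t], of k x]
        unfolding Dpow_double by (simp add: z_def y_def)
      moreover have "N (D t y) \<le> \<omega> (Suc k) h x"
        using modulus_upper[OF t, of "Suc k" x] by (simp add: y_def)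
      ultimately show ?thesis by (auto intro!: mult_left_mono add_mono)
    qed
    finally show "N ((D t ^^ k) x) \<le> ennreal ((1 / 2) ^ k) * C * \<omega> (Suc k) h x + ennreal ((1 / 2) ^ k) * \<omega> k (2 * h) x"
      by (simp add: y_def distrib_left mult.assoc add.commute)
  qed
  moreover have "ennreal ((1 / 2) ^ k) * C < top" using C by (simp add: ennreal_mult_less_top)
  ultimately show ?thesis using that by blast
qed

end

section \<open>Change of order and discretization\<close>

lemma ennreal_suminf_Suc_le: "(\<Sum>n. f (Suc n)) \<le> (\<Sum>n. f n :: ennreal)"
proof (rule suminf_le_const)
  fix J
  have "(\<Sum>n<J. f (Suc n)) \<le> (\<Sum>n<Suc J. f n)"
    unfolding sum.lessThan_Suc_shift by simp
  also have "\<dots> \<le> (\<Sum>n. f n)" by (intro sum_le_suminf) auto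
  finally show "(\<Sum>n<J. f (Suc n)) \<le> (\<Sum>n. f n)" .
qed simp

lemma ennreal_le_suminf: "f n \<le> (\<Sum>n. f n :: ennreal)"
  using sum_le_suminf[of f "{n}"] by simp

text \<open>The scales above and below h form separate families because they are estimated
  differently: above h by the norm, below h by the moduli.\<close>

lemma dyadic_cover:
  fixes h u :: real
  assumes "0 < h" "0 < u"
  obtains n where "u \<in> {2 ^ n * h..<2 * (2 ^ n * h)}"
  | n where "u \<in> {(1 / 2) ^ Suc n * h..<2 * ((1 / 2) ^ Suc n * h)}"
proof (cases "h \<le> u")
  case True
  obtain m where "u / h < 2 ^ m" using real_arch_pow[of 2 "u / h"] by auto
  then have ex: "u < 2 ^ m * h" using assms by (simp add: field_simps)
  define m where "m = (LEAST m. u < 2 ^ m * h)"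
  have m: "u < 2 ^ m * h" unfolding m_def using ex by (rule LeastI)
  then have "m \<noteq> 0" using True by (cases m) auto
  then obtain n where n: "m = Suc n" using not0_implies_Suc by blast
  then have "\<not> u < 2 ^ n * h" unfolding m_def by (metis lessI not_less_Least)
  then show ?thesis using that(1)[of n] m n by simp
next
  case False
  obtain m where "(1 / 2) ^ m < u / h" using real_arch_pow_inv[of "u / h" "1 / 2"] assms by auto
  then have ex: "(1 / 2) ^ m * h \<le> u" using assms by (simp add: field_simps)
  define m where "m = (LEAST m. (1 / 2) ^ m * h \<le> u)"
  have m: "(1 / 2) ^ m * h \<le> u" unfolding m_def using ex by (rule LeastI)
  then have "m \<noteq> 0" using False by (cases m) auto
  then obtain n where n: "m = Suc n" using not0_implies_Suc by blast
  then have "\<not> (1 / 2) ^ n * h \<le> u" unfolding m_def by (metis lessI not_less_Least)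
  then show ?thesis using that(2)[of n] m n by simp
qed

lemma power_powr_swap: "0 < c \<Longrightarrow> (c ^ n) powr a = (c powr a) ^ n" for c :: real
  by (simp add: powr_power powr_powr mult.commute flip: powr_realpow)

context flow_norm
begin

lemma W_scale:
  assumes "0 < c" "0 < h"
  shows "W s k x (c * h) = ennreal (c powr (- s)) * (ennreal (h powr (- s)) * \<omega> k (c * h) x)"
  using assms by (simp add: W_def powr_mult ennreal_mult mult.assoc)

text \<open>On [h, 2h) the modulus is at least its value at h and the weight at least (2h)^(-r),
  while the interval has norm at least 1/2. This is the embedding of the Besov space for p into the
  one for \<infinity>, with a constant independent of p.\<close>

lemma haar_Lp_W_ge:
  assumes "0 < h" "0 \<le> r" "1 \<le> p"
  shows "W r k x h \<le> ennreal (2 * 2 powr r) * haar_Lp p (W r k x)"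
proof -
  define c where "c = ennreal ((2 * h) powr (- r)) * \<omega> k h x"
  have "W r k x h = ennreal (2 powr r) * c"
    using assms by (simp add: W_def c_def powr_mult powr_minus flip: ennreal_mult mult.assoc)
  also have "\<dots> = ennreal (2 * 2 powr r) * (c * ennreal (1 / 2))"
  proof -
    have "ennreal (2 powr r) = ennreal (2 * 2 powr r) * ennreal (1 / 2)"
      by (subst ennreal_mult[symmetric]) auto
    then show ?thesis by (simp only: mult_ac)
  qed
  also have "\<dots> \<le> ennreal (2 * 2 powr r) * (c * haar_Lp p (indicator {h..<2 * h}))"
    using assms by (intro mult_left_mono haar_Lp_indicator_dyadic) auto
  also have "\<dots> = ennreal (2 * 2 powr r) * haar_Lp p (\<lambda>u. c * indicator {h..<2 * h} u)"
    using assms by (subst haar_Lp_cmult) auto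
  also have "\<dots> \<le> ennreal (2 * 2 powr r) * haar_Lp p (W r k x)"
  proof (intro mult_left_mono haar_Lp_mono)
    fix u :: real
    show "c * indicator {h..<2 * h} u \<le> W r k x u"
    proof (cases "u \<in> {h..<2 * h}")
      case True
      then have "(2 * h) powr (- r) \<le> u powr (- r)"
        using assms by (intro powr_mono2') auto
      then show ?thesis using True
        by (auto simp: c_def W_def intro!: mult_mono ennreal_leI modulus_mono)
    qed auto
  qed auto
  finally show ?thesis .
qed

text \<open>Multiplied by h^(-s), Marchaud's inequality becomes a recursion from h to 2h with factor
  \<theta> = 2^(s-k) < 1. It is unrolled pointwise and only then integrated: the seminorm of order k
  could be infinite and so could not be subtracted.\<close>

lemma besov_order_Suc:
  assumes "0 < s" "s < real k"
  shows "\<exists>C<top. \<forall>x p. 1 \<le> p \<longrightarrow>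
    N x + haar_Lp p (W s k x) \<le> C * (N x + haar_Lp p (W s (Suc k) x))"
proof -
  obtain C where C: "C < top"
    "\<And>h x. \<omega> k h x \<le> C * \<omega> (Suc k) h x + ennreal ((1 / 2) ^ k) * \<omega> k (2 * h) x"
    using marchaud[of k] by blast
  define \<theta> where "\<theta> = 2 powr (s - real k)"
  have "2 powr (s - real k) < 2 powr 0" using assms by (intro powr_less_mono) auto
  then have \<theta>: "0 \<le> \<theta>" "\<theta> < 1" by (auto simp: \<theta>_def)
  have \<theta>2: "\<theta> * 2 powr (- s) = (1 / 2) ^ k"
    by (simp add: \<theta>_def powr_realpow power_one_over divide_simps flip: powr_add) (simp add: powr_minus powr_realpow)
  have step: "W s k x h \<le> C * W s (Suc k) x h + ennreal \<theta> * W s k x (2 * h)" if "0 < h" for h x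
  proof -
    have "W s k x h \<le> ennreal (h powr (- s)) * (C * \<omega> (Suc k) h x + ennreal ((1 / 2) ^ k) * \<omega> k (2 * h) x)"
      unfolding W_def by (intro mult_left_mono C) auto
    also have "\<dots> = C * W s (Suc k) x h + ennreal ((1 / 2) ^ k) * (ennreal (h powr (- s)) * \<omega> k (2 * h) x)"
      unfolding W_def distrib_left by (simp only: mult_ac)
    also have "ennreal ((1 / 2) ^ k) * (ennreal (h powr (- s)) * \<omega> k (2 * h) x) = ennreal \<theta> * W s k x (2 * h)"
      using that \<theta> unfolding \<theta>2[symmetric] by (simp add: W_scale ennreal_mult mult.assoc)
    finally show ?thesis .
  qed
  define C' where "C' = 1 + ennreal (1 / (1 - \<theta>)) * C"
  have "N x + haar_Lp p (W s k x) \<le> C' * (N x + haar_Lp p (W s (Suc k) x))" if p: "1 \<le> p" for x p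
  proof (cases "N x = top")
    case True
    then show ?thesis by (simp add: C'_def distrib_right)
  next
    case False
    \<comment> \<open>If N x is finite, the weighted modulus is bounded along the scales 2^j h,
      since the modulus is bounded and the weight decreases; hence the remainder of the unrolled
      recursion vanishes.\<close>
    have pt: "W s k x h \<le> (\<Sum>j. ennreal \<theta> ^ j * (C * W s (Suc k) x (2 ^ j * h)))" if h: "0 < h" for h
    proof -
      have "W s k x (2 ^ j * h) \<le> ennreal (h powr (- s)) * ((K + 1) ^ k * N x)" for j
        unfolding W_def using h assms
        by (intro mult_mono ennreal_leI modulus_le powr_mono2') auto
      moreover have "ennreal (h powr (- s)) * ((K + 1) ^ k * N x) < top"
        using False K1_finite by (simp add: ennreal_mult_less_top less_top)
      moreover have "W s k x (2 ^ j * h) \<le> C * W s (Suc k) x (2 ^ j * h) + ennreal \<theta> * W s k x (2 ^ Suc j * h)" for j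
        using step[of "2 ^ j * h" x] h by (simp add: mult.assoc)
      ultimately show ?thesis
        using ennreal_le_geometric_sum[of "\<lambda>j. W s k x (2 ^ j * h)" "\<lambda>j. C * W s (Suc k) x (2 ^ j * h)" \<theta>
            "ennreal (h powr (- s)) * ((K + 1) ^ k * N x)"] \<theta>
        by simp
    qed
    have "haar_Lp p (W s k x) \<le> haar_Lp p (\<lambda>h. \<Sum>j. ennreal \<theta> ^ j * (C * W s (Suc k) x (2 ^ j * h)))"
      by (intro haar_Lp_mono pt)
    also have "\<dots> \<le> ennreal (1 / (1 - \<theta>)) * haar_Lp p (\<lambda>h. C * W s (Suc k) x h)"
      using \<theta> p by (intro haar_Lp_geometric[of "\<lambda>h. C * W s (Suc k) x h"]) auto
    also have "\<dots> = ennreal (1 / (1 - \<theta>)) * C * haar_Lp p (W s (Suc k) x)"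
      using p by (simp add: haar_Lp_cmult mult.assoc)
    also have "\<dots> \<le> C' * haar_Lp p (W s (Suc k) x)"
      unfolding C'_def by (intro mult_right_mono) auto
    finally have "haar_Lp p (W s k x) \<le> C' * haar_Lp p (W s (Suc k) x)" .
    moreover have "1 * N x \<le> C' * N x" unfolding C'_def by (intro mult_right_mono) auto
    ultimately show ?thesis by (simp add: distrib_left add_mono)
  qed
  moreover have "C' < top" using C by (simp add: C'_def ennreal_mult_less_top)
  ultimately show ?thesis by blast
qed

lemma besov_order:
  assumes "0 < s" "s < real k" "k \<le> m"
  shows "\<exists>C<top. \<forall>x p. 1 \<le> p \<longrightarrow>
    N x + haar_Lp p (W s k x) \<le> C * (N x + haar_Lp p (W s m x))"
  using assms(3)
proof (induction rule: dec_induct)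
  case base
  show ?case by (intro exI[of _ 1]) auto
next
  case (step m)
  then obtain C where C: "C < top" "\<And>x p. 1 \<le> p \<Longrightarrow>
    N x + haar_Lp p (W s k x) \<le> C * (N x + haar_Lp p (W s m x))" by blast
  have "s < real m" using assms step by auto
  from besov_order_Suc[OF assms(1) this] obtain C' where C': "C' < top" "\<And>x p. 1 \<le> p \<Longrightarrow>
    N x + haar_Lp p (W s m x) \<le> C' * (N x + haar_Lp p (W s (Suc m) x))" by blast
  have "N x + haar_Lp p (W s k x) \<le> (C * C') * (N x + haar_Lp p (W s (Suc m) x))" if "1 \<le> p" for x p
    unfolding mult.assoc by (rule order_trans[OF C(2)[OF that] mult_left_mono[OF C'(2)[OF that]]]) simp
  then show ?case using C C' by (intro exI[of _ "C * C'"]) (auto simp: ennreal_mult_less_top)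
qed

text \<open>Equal to h^r times a dyadic Riemann sum for the integral of u^(-r) times the modulus at
  u, with respect to du / u, over scales up to h. As a sum of absolute sizes it dominates the L^p
  norm over those scales for every p, which is why p disappears from the final space.\<close>

definition dyadic_sum :: "real \<Rightarrow> nat \<Rightarrow> 'a \<Rightarrow> real \<Rightarrow> ennreal" where
  "dyadic_sum r k x h = (\<Sum>n. ennreal (2 powr r) ^ n * \<omega> k ((1 / 2) ^ n * h) x)"

text \<open>Scales from h upwards contribute a convergent geometric series times the norm; scales
  below h contribute the dyadic sum.\<close>

lemma haar_Lp_W_le_dyadic_sum:
  assumes r: "0 < r"
  shows "\<exists>C<top. \<forall>x h p. 0 < h \<longrightarrow> 1 \<le> p \<longrightarrow>
    haar_Lp p (W r k x) \<le> C * ennreal (h powr (- r)) * (N x + dyadic_sum r k x h)"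
proof -
  define A where "A = ennreal (1 / (1 - 2 powr (- r))) * (K + 1) ^ k"
  define B where "B = ennreal (2 powr r)"
  have AB: "A + B < top" using K1_finite by (simp add: A_def B_def ennreal_mult_less_top)
  have "2 powr (- r) < 2 powr 0" using r by (intro powr_less_mono) auto
  then have lt1: "2 powr (- r) < 1" by simp
  have "haar_Lp p (W r k x) \<le> (A + B) * ennreal (h powr (- r)) * (N x + dyadic_sum r k x h)"
    if h: "0 < h" and p: "1 \<le> p" for x h p
  proof -
    define H where "H = ennreal (h powr (- r))"
    define a where "a n = ennreal ((2 ^ n * h) powr (- r)) * ((K + 1) ^ k * N x)" for n :: nat
    \<comment> \<open>On the n-th interval below h the weight is largest at the left end and the
      modulus is bounded by its value at the right end. This shift by one dyadic step produces the
      factor 2^r in B.\<close>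
    define b where "b n = ennreal (((1 / 2) ^ Suc n * h) powr (- r)) * \<omega> k ((1 / 2) ^ n * h) x" for n
    have "W r k x u \<le> (\<Sum>n. a n * indicator {2 ^ n * h..<2 * (2 ^ n * h)} u)
        + (\<Sum>n. b n * indicator {(1 / 2) ^ Suc n * h..<2 * ((1 / 2) ^ Suc n * h)} u)" (is "_ \<le> ?a + ?b")
      if u: "0 < u" for u
      using h u
    proof (cases rule: dyadic_cover)
      case (1 n)
      have "W r k x u \<le> a n"
        unfolding W_def a_def using 1 h r by (intro mult_mono ennreal_leI powr_mono2' modulus_le) auto
      also have "\<dots> \<le> ?a" using ennreal_le_suminf[of "\<lambda>n. a n * indicator {2 ^ n * h..<2 * (2 ^ n * h)} u" n] 1 by simp
      finally show ?thesis by (simp add: add_increasing2)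
    next
      case (2 n)
      have "W r k x u \<le> b n"
        unfolding W_def b_def using 2 h r by (intro mult_mono ennreal_leI powr_mono2' modulus_mono) auto
      also have "\<dots> \<le> ?b"
        using ennreal_le_suminf[of "\<lambda>n. b n * indicator {(1 / 2) ^ Suc n * h..<2 * ((1 / 2) ^ Suc n * h)} u" n] 2 by simp
      finally show ?thesis by (simp add: add_increasing)
    qed
    then have "haar_Lp p (W r k x) \<le> haar_Lp p (\<lambda>u. (\<Sum>n. a n * indicator {2 ^ n * h..<2 * (2 ^ n * h)} u)
        + (\<Sum>n. b n * indicator {(1 / 2) ^ Suc n * h..<2 * ((1 / 2) ^ Suc n * h)} u))"
      by (rule haar_Lp_mono)
    also have "\<dots> \<le> haar_Lp p (\<lambda>u. \<Sum>n. a n * indicator {2 ^ n * h..<2 * (2 ^ n * h)} u)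
        + haar_Lp p (\<lambda>u. \<Sum>n. b n * indicator {(1 / 2) ^ Suc n * h..<2 * ((1 / 2) ^ Suc n * h)} u)"
      using p by (intro haar_Lp_add) auto
    also have "\<dots> \<le> (\<Sum>n. a n) + (\<Sum>n. b n)"
    proof -
      have "haar_Lp p (\<lambda>u. \<Sum>n. c n * indicator {y n..<2 * y n} u) \<le> (\<Sum>n. c n)"
        if y: "\<And>n. 0 < y n" for c :: "nat \<Rightarrow> ennreal" and y
      proof -
        have "haar_Lp p (\<lambda>u. \<Sum>n. c n * indicator {y n..<2 * y n} u) \<le>
            (\<Sum>n. haar_Lp p (\<lambda>u. c n * indicator {y n..<2 * y n} u))"
          using p by (intro haar_Lp_suminf) auto
        also have "\<dots> = (\<Sum>n. c n * haar_Lp p (indicator {y n..<2 * y n}))"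
          using p by (subst haar_Lp_cmult) auto
        also have "\<dots> \<le> (\<Sum>n. c n * 1)"
          using y p by (intro suminf_le mult_left_mono haar_Lp_indicator_dyadic) auto
        finally show ?thesis by simp
      qed
      from this[of "\<lambda>n. 2 ^ n * h" a] this[of "\<lambda>n. (1 / 2) ^ Suc n * h" b] h
      show ?thesis by (intro add_mono) auto
    qed
    also have "(\<Sum>n. a n) = H * (A * N x)"
    proof -
      have "a n = ennreal (2 powr (- r)) ^ n * (H * ((K + 1) ^ k * N x))" for n
        using h by (simp add: a_def H_def powr_mult power_powr_swap ennreal_mult ennreal_power mult.assoc)
      then show ?thesis using lt1 suminf_ennreal_geometric[of "2 powr (- r)"]
        by (simp add: A_def mult_ac)
    qed
    also have "(\<Sum>n. b n) = H * (B * dyadic_sum r k x h)"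
    proof -
      have "b n = (H * B) * (ennreal (2 powr r) ^ n * \<omega> k ((1 / 2) ^ n * h) x)" for n
      proof -
        have "((1 / 2) ^ Suc n * h) powr (- r) = h powr (- r) * 2 powr r * (2 powr r) ^ n"
        proof -
          have "((1 / 2) ^ Suc n * h) powr (- r) = ((1 / 2) ^ Suc n) powr (- r) * h powr (- r)"
            using h by (intro powr_mult)
          also have "((1 / 2) ^ Suc n) powr (- r) = ((1 / 2) powr (- r)) ^ Suc n" by (rule power_powr_swap) simp
          also have "(1 / 2) powr (- r) = 2 powr r" by (simp add: powr_divide powr_minus)
          finally show ?thesis by (simp add: mult_ac)
        qed
        then show ?thesis
          by (simp add: b_def H_def B_def ennreal_mult ennreal_power mult.assoc)
      qed
      then show ?thesis by (simp add: dyadic_sum_def mult.assoc)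
    qed
    also have "H * (A * N x) + H * (B * dyadic_sum r k x h) \<le> (A + B) * H * (N x + dyadic_sum r k x h)"
    proof -
      have "(A + B) * H * (N x + dyadic_sum r k x h) = (H * (A * N x) + H * (B * dyadic_sum r k x h))
          + (H * (A * dyadic_sum r k x h) + H * (B * N x))"
        by (simp add: distrib_left distrib_right mult_ac add_ac)
      then show ?thesis by simp
    qed
    finally show ?thesis by (simp add: H_def)
  qed
  then show ?thesis using AB by blast
qed

text \<open>Marchaud's inequality at the scale 2^(-n-1) h bounds each term by the previous one with
  factor 2^(r-k) < 1. The recursion starts from the term n = 0, which the norm controls, so
  \<open>ennreal_suminf_absorb\<close> applies even if the sum is infinite.\<close>

lemma dyadic_sum_order_Suc:
  assumes "r < real k"
  shows "\<exists>C<top. \<forall>x h. N x + dyadic_sum r k x h \<le> C * (N x + dyadic_sum r (Suc k) x h)"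
proof -
  obtain C where C: "C < top"
    "\<And>h x. \<omega> k h x \<le> C * \<omega> (Suc k) h x + ennreal ((1 / 2) ^ k) * \<omega> k (2 * h) x"
    using marchaud[of k] by blast
  define \<theta> where "\<theta> = 2 powr (r - real k)"
  have "2 powr (r - real k) < 2 powr 0" using assms by (intro powr_less_mono) auto
  then have \<theta>: "0 \<le> \<theta>" "\<theta> < 1" by (auto simp: \<theta>_def)
  have \<theta>2: "\<theta> = 2 powr r * (1 / 2) ^ k"
    by (simp add: \<theta>_def powr_diff powr_realpow power_one_over divide_simps)
  define e where "e = ennreal (1 / (1 - \<theta>))"
  define C' where "C' = 1 + e * (K + 1) ^ k + e * C"
  have "N x + dyadic_sum r k x h \<le> C' * (N x + dyadic_sum r (Suc k) x h)" for x h
  proof -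
    define X where "X k n = ennreal (2 powr r) ^ n * \<omega> k ((1 / 2) ^ n * h) x" for k n
    have step: "X k (Suc n) \<le> C * X (Suc k) (Suc n) + ennreal \<theta> * X k n" for n
    proof -
      have "X k (Suc n) \<le> ennreal (2 powr r) ^ Suc n * (C * \<omega> (Suc k) ((1 / 2) ^ Suc n * h) x
          + ennreal ((1 / 2) ^ k) * \<omega> k (2 * ((1 / 2) ^ Suc n * h)) x)"
        unfolding X_def by (intro mult_left_mono C) auto
      also have "\<dots> = C * X (Suc k) (Suc n) + (ennreal (2 powr r) * ennreal ((1 / 2) ^ k)) * X k n"
        by (simp add: X_def distrib_left mult_ac)
      also have "ennreal (2 powr r) * ennreal ((1 / 2) ^ k) = ennreal \<theta>"
        unfolding \<theta>2 by (subst ennreal_mult) auto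
      finally show ?thesis .
    qed
    have "(\<Sum>n. X k n) \<le> e * (X k 0 + (\<Sum>n. C * X (Suc k) (Suc n)))"
      unfolding e_def using step \<theta> by (rule ennreal_suminf_absorb)
    also have "\<dots> \<le> e * ((K + 1) ^ k * N x + C * (\<Sum>n. X (Suc k) n))"
      using ennreal_suminf_Suc_le[of "X (Suc k)"]
      by (auto intro!: mult_left_mono add_mono simp: X_def modulus_le)
    finally have "dyadic_sum r k x h \<le> e * (K + 1) ^ k * N x + e * C * dyadic_sum r (Suc k) x h"
      by (simp add: X_def dyadic_sum_def distrib_left mult.assoc)
    then have "N x + dyadic_sum r k x h \<le> N x + (e * (K + 1) ^ k * N x + e * C * dyadic_sum r (Suc k) x h)"
      by (rule add_left_mono)
    also have "\<dots> \<le> C' * N x + C' * dyadic_sum r (Suc k) x h"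
    proof -
      have "N x + e * (K + 1) ^ k * N x \<le> C' * N x"
        unfolding C'_def distrib_right by simp
      moreover have "e * C * dyadic_sum r (Suc k) x h \<le> C' * dyadic_sum r (Suc k) x h"
        unfolding C'_def by (intro mult_right_mono) auto
      ultimately show ?thesis unfolding add.assoc[symmetric] by (rule add_mono)
    qed
    finally show ?thesis by (simp add: distrib_left)
  qed
  moreover have "C' < top" using C K1_finite by (simp add: C'_def e_def ennreal_mult_less_top)
  ultimately show ?thesis by blast
qed

lemma dyadic_sum_order:
  assumes "r < real k" "k \<le> m"
  shows "\<exists>C<top. \<forall>x h. N x + dyadic_sum r k x h \<le> C * (N x + dyadic_sum r m x h)"
  using assms(2)
proof (induction rule: dec_induct)
  case base
  show ?case by (intro exI[of _ 1]) auto
next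
  case (step m)
  then obtain C where C: "C < top" "\<And>x h. N x + dyadic_sum r k x h \<le> C * (N x + dyadic_sum r m x h)"
    by blast
  have "r < real m" using assms step by auto
  from dyadic_sum_order_Suc[OF this] obtain C' where C': "C' < top"
    "\<And>x h. N x + dyadic_sum r m x h \<le> C' * (N x + dyadic_sum r (Suc m) x h)" by blast
  have "N x + dyadic_sum r k x h \<le> (C * C') * (N x + dyadic_sum r (Suc m) x h)" for x h
    unfolding mult.assoc by (rule order_trans[OF C(2) mult_left_mono[OF C'(2)]]) simp
  then show ?case using C C' by (intro exI[of _ "C * C'"]) (auto simp: ennreal_mult_less_top)
qed

end

section \<open>Iterated Besov norms\<close>

context flow_norm
begin

section \<open>The Besov norm as a new base norm\<close>

lemma modulus_add: "\<omega> k h (x + y) \<le> \<omega> k h x + \<omega> k h y"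
  by (rule modulus_least) (auto simp: Dpow_simps intro!: order_trans[OF norm_add] add_mono modulus_upper)

lemma modulus_scale: "\<omega> k h (c *\<^sub>R x) \<le> ennreal \<bar>c\<bar> * \<omega> k h x"
  by (rule modulus_least) (auto simp: Dpow_simps intro!: order_trans[OF norm_scale] mult_left_mono modulus_upper)

lemma modulus_flow: "\<omega> k h (\<psi> t x) \<le> K * \<omega> k h x"
  by (rule modulus_least)
     (auto simp flip: flow_Dpow intro!: order_trans[OF norm_flow] mult_left_mono modulus_upper)

text \<open>The flow commutes with differences, so the Besov norm inherits the same bound K.
  Interpreting the locale with this norm is what iterates the Besov construction.\<close>

lemma flow_norm_besov:
  assumes "1 \<le> p"
  shows "flow_norm \<psi> (\<lambda>x. N x + haar_Lp p (W r k x)) K"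
proof unfold_locales
  fix x y
  have "haar_Lp p (W r k (x + y)) \<le> haar_Lp p (\<lambda>h. W r k x h + W r k y h)"
    unfolding W_def distrib_left[symmetric] by (intro haar_Lp_mono mult_left_mono modulus_add) auto
  also have "\<dots> \<le> haar_Lp p (W r k x) + haar_Lp p (W r k y)"
    using assms by (intro haar_Lp_add) auto
  finally have "N (x + y) + haar_Lp p (W r k (x + y)) \<le> (N x + N y) + (haar_Lp p (W r k x) + haar_Lp p (W r k y))"
    by (intro add_mono norm_add)
  then show "N (x + y) + haar_Lp p (W r k (x + y)) \<le> N x + haar_Lp p (W r k x) + (N y + haar_Lp p (W r k y))"
    by (simp add: add_ac)
next
  fix c x
  have "haar_Lp p (W r k (c *\<^sub>R x)) \<le> haar_Lp p (\<lambda>h. ennreal \<bar>c\<bar> * W r k x h)"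
    unfolding W_def mult.left_commute[of "ennreal \<bar>c\<bar>"]
    by (intro haar_Lp_mono mult_left_mono modulus_scale) auto
  then show "N (c *\<^sub>R x) + haar_Lp p (W r k (c *\<^sub>R x)) \<le> ennreal \<bar>c\<bar> * (N x + haar_Lp p (W r k x))"
    using assms by (simp add: haar_Lp_cmult distrib_left add_mono norm_scale)
next
  fix t x
  have "haar_Lp p (W r k (\<psi> t x)) \<le> haar_Lp p (\<lambda>h. K * W r k x h)"
    unfolding W_def mult.left_commute[of K]
    by (intro haar_Lp_mono mult_left_mono modulus_flow) auto
  then show "N (\<psi> t x) + haar_Lp p (W r k (\<psi> t x)) \<le> K * (N x + haar_Lp p (W r k x))"
    using assms by (simp add: haar_Lp_cmult distrib_left add_mono norm_flow)
qed (rule K_finite)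

lemma besov_add_order:
  assumes "1 \<le> p"
  shows "haar_Lp p (W r (j + k) x) \<le> (K + 1) ^ j * haar_Lp p (W r k x)"
proof -
  have "haar_Lp p (W r (j + k) x) \<le> haar_Lp p (\<lambda>h. (K + 1) ^ j * W r k x h)"
    unfolding W_def mult.left_commute[of "(K + 1) ^ j"]
    by (intro haar_Lp_mono mult_left_mono modulus_add_order) auto
  then show ?thesis using assms by (simp add: haar_Lp_cmult)
qed

text \<open>This direction embeds the iterated space into the one of smoothness r + s. A difference
  of order l + m is an l-th difference of b = \<open>(D t ^^ m) x\<close> with the same step t, and
  \<open>haar_Lp_W_ge\<close> turns the Besov norm of b into a gain of h^r.\<close>

lemma besov_le_iterated:
  assumes "0 < r" "0 < s" "r + s < real k" "1 \<le> p" "1 \<le> q"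
  shows "\<exists>C<top. \<forall>x. N x + haar_Lp q (W (r + s) k x) \<le>
    C * ((N x + haar_Lp p (W r l x))
      + haar_Lp q (flow_norm.W \<psi> (\<lambda>x. N x + haar_Lp p (W r l x)) s m x))"
proof -
  define N1 where "N1 = (\<lambda>x. N x + haar_Lp p (W r l x))"
  interpret I: flow_norm \<psi> N1 K
    unfolding N1_def by (rule flow_norm_besov) fact
  define c where "c = ennreal (2 * 2 powr r)"
  have pt: "W (r + s) (l + m) x h \<le> c * I.W s m x h" if h: "0 < h" for x h
  proof -
    have "\<omega> (l + m) h x \<le> ennreal (h powr r) * (c * I.\<omega> m h x)"
    proof (rule modulus_least)
      fix t :: "real ^ 'd" assume t: "(\<Sum>j\<in>UNIV. \<bar>t $ j\<bar>) \<le> h"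
      define b where "b = (D t ^^ m) x"
      have "N ((D t ^^ (l + m)) x) \<le> \<omega> l h b"
        using modulus_upper[OF t, of l b] by (simp add: b_def funpow_add)
      also have "\<dots> = ennreal (h powr r) * W r l b h"
        using h by (simp add: W_def mult.assoc[symmetric] ennreal_mult[symmetric] powr_minus)
      also have "\<dots> \<le> ennreal (h powr r) * (c * haar_Lp p (W r l b))"
        unfolding c_def using h assms by (intro mult_left_mono haar_Lp_W_ge) auto
      also have "\<dots> \<le> ennreal (h powr r) * (c * N1 b)"
        unfolding N1_def by (intro mult_left_mono) auto
      also have "\<dots> \<le> ennreal (h powr r) * (c * I.\<omega> m h x)"
        unfolding b_def by (intro mult_left_mono I.modulus_upper t) auto
      finally show "N ((D t ^^ (l + m)) x) \<le> ennreal (h powr r) * (c * I.\<omega> m h x)" .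
    qed
    then have "W (r + s) (l + m) x h \<le> ennreal (h powr (- (r + s))) * (ennreal (h powr r) * (c * I.\<omega> m h x))"
      unfolding W_def by (rule mult_left_mono) simp
    also have "\<dots> = (ennreal (h powr (- (r + s))) * ennreal (h powr r)) * (c * I.\<omega> m h x)"
      by (simp only: mult.assoc)
    also have "ennreal (h powr (- (r + s))) * ennreal (h powr r) = ennreal (h powr (- s))"
      by (simp flip: ennreal_mult powr_add)
    also have "\<dots> * (c * I.\<omega> m h x) = c * I.W s m x h" unfolding I.W_def by (rule mult.left_commute)
    finally show ?thesis .
  qed
  have L: "haar_Lp q (W (r + s) (l + m) x) \<le> c * haar_Lp q (I.W s m x)" for x
  proof -
    have "haar_Lp q (W (r + s) (l + m) x) \<le> haar_Lp q (\<lambda>h. c * I.W s m x h)"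
      by (intro haar_Lp_mono pt)
    then show ?thesis using assms by (simp add: haar_Lp_cmult)
  qed
  have "0 < r + s" using assms by simp
  \<comment> \<open>The orders k and l + m are unrelated, so both are compared with their sum: k is
    raised to it by iterated Marchaud, and l + m by boundedness of differences.\<close>
  from besov_order[OF this assms(3), of "k + (l + m)"] obtain C where C: "C < top"
    "\<And>x. N x + haar_Lp q (W (r + s) k x) \<le> C * (N x + haar_Lp q (W (r + s) (k + (l + m)) x))"
    using assms(5) by auto
  define E where "E = 1 + (K + 1) ^ k * c"
  have "N x + haar_Lp q (W (r + s) k x) \<le> (C * E) * (N1 x + haar_Lp q (I.W s m x))" for x
  proof -
    have "haar_Lp q (W (r + s) (k + (l + m)) x) \<le> (K + 1) ^ k * (c * haar_Lp q (I.W s m x))"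
      using assms(5) by (intro order_trans[OF besov_add_order] mult_left_mono L) auto
    also have "\<dots> \<le> E * haar_Lp q (I.W s m x)"
      unfolding E_def mult.assoc[symmetric] by (intro mult_right_mono) auto
    finally have "haar_Lp q (W (r + s) (k + (l + m)) x) \<le> E * haar_Lp q (I.W s m x)" .
    moreover have "N x \<le> E * N1 x"
      using mult_mono[of 1 E "N x" "N1 x"] by (simp add: E_def N1_def)
    ultimately have "N x + haar_Lp q (W (r + s) (k + (l + m)) x) \<le> E * (N1 x + haar_Lp q (I.W s m x))"
      by (simp add: distrib_left add_mono)
    then show ?thesis
      unfolding mult.assoc by (intro order_trans[OF C(2)] mult_left_mono) auto
  qed
  moreover have "C * E < top"
    using C K1_finite by (simp add: E_def c_def ennreal_mult_less_top)
  ultimately show ?thesis unfolding N1_def by blast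
qed

lemma besov_le_dyadic_sum:
  assumes "0 < r" "r < real l" "l \<le> n"
  shows "\<exists>C<top. \<forall>x h p. 0 < h \<longrightarrow> 1 \<le> p \<longrightarrow>
    haar_Lp p (W r l x) \<le> C * ennreal (h powr (- r)) * (N x + dyadic_sum r n x h)"
proof -
  obtain C where C: "C < top" "\<And>x h p. 0 < h \<Longrightarrow> 1 \<le> p \<Longrightarrow>
    haar_Lp p (W r l x) \<le> C * ennreal (h powr (- r)) * (N x + dyadic_sum r l x h)"
    using haar_Lp_W_le_dyadic_sum[OF assms(1)] by blast
  obtain C' where C': "C' < top" "\<And>x h. N x + dyadic_sum r l x h \<le> C' * (N x + dyadic_sum r n x h)"
    using dyadic_sum_order[OF assms(2,3)] by blast
  have "haar_Lp p (W r l x) \<le> (C * C') * ennreal (h powr (- r)) * (N x + dyadic_sum r n x h)"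
    if "0 < h" "1 \<le> p" for x h p
  proof -
    have "haar_Lp p (W r l x) \<le> C * ennreal (h powr (- r)) * (C' * (N x + dyadic_sum r n x h))"
      by (rule order_trans[OF C(2)[OF that] mult_left_mono[OF C'(2)]]) simp
    then show ?thesis by (simp only: mult_ac)
  qed
  then show ?thesis using C C' by (intro exI[of _ "C * C'"]) (auto simp: ennreal_mult_less_top)
qed

text \<open>Each term satisfies 2^(jr) h^(-(r+s)) = 2^(-js) (2^(-j) h)^(-(r+s)). The surplus
  smoothness s thus becomes the geometric factor that makes the sum over scales converge.\<close>

lemma dyadic_sum_eq:
  assumes "0 < h"
  shows "ennreal (h powr (- (r + s))) * dyadic_sum r n x h =
    (\<Sum>j. ennreal (2 powr (- s)) ^ j * W (r + s) n x ((1 / 2) ^ j * h))"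
proof -
  have "ennreal (h powr (- (r + s))) * (ennreal (2 powr r) ^ j * y) =
      ennreal (2 powr (- s)) ^ j * (ennreal (((1 / 2) ^ j * h) powr (- (r + s))) * y)" for j y
  proof -
    have "((1 / 2) ^ j * h) powr (- (r + s)) = ((1 / 2) ^ j) powr (- (r + s)) * h powr (- (r + s))"
      using assms by (intro powr_mult)
    also have "((1 / 2) ^ j :: real) powr (- (r + s)) = (2 powr (r + s)) ^ j"
    proof -
      have half: "(1 / 2 :: real) powr (- a) = 2 powr a" for a by (simp add: powr_divide powr_minus)
      show ?thesis unfolding half[symmetric] by (rule power_powr_swap) simp
    qed
    finally have "(2 powr (- s)) ^ j * ((1 / 2) ^ j * h) powr (- (r + s)) =
        (2 powr (- s) * 2 powr (r + s)) ^ j * h powr (- (r + s))"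
      by (simp add: power_mult_distrib)
    also have "2 powr (- s) * 2 powr (r + s) = 2 powr r" by (simp flip: powr_add)
    finally have "ennreal ((2 powr (- s)) ^ j * ((1 / 2) ^ j * h) powr (- (r + s))) =
      ennreal ((2 powr r) ^ j * h powr (- (r + s)))" by simp
    then show ?thesis
      by (simp add: ennreal_mult ennreal_power mult.assoc[symmetric])
         (simp add: mult.commute)
  qed
  then show ?thesis unfolding dyadic_sum_def W_def ennreal_suminf_cmult[symmetric] by simp
qed

text \<open>The dyadic sum is taken at h = 1, and each of its terms is bounded by the supremum form
  of the seminorm of smoothness r + s. Since s > 0, the series converges for any pair p, q.\<close>

lemma besov_embedding:
  assumes "0 < r" "0 < s" "r < real l" "l \<le> n" "1 \<le> p" "1 \<le> q"
  shows "\<exists>C<top. \<forall>x. N x + haar_Lp p (W r l x) \<le> C * (N x + haar_Lp q (W (r + s) n x))"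
proof -
  obtain C where C: "C < top" "\<And>x h p. 0 < h \<Longrightarrow> 1 \<le> p \<Longrightarrow>
    haar_Lp p (W r l x) \<le> C * ennreal (h powr (- r)) * (N x + dyadic_sum r n x h)"
    using besov_le_dyadic_sum[OF assms(1,3,4)] by blast
  have "2 powr (- s) < 2 powr 0" using assms by (intro powr_less_mono) auto
  then have \<theta>: "2 powr (- s) < 1" by simp
  define c where "c = ennreal (1 / (1 - 2 powr (- s))) * ennreal (2 * 2 powr (r + s))"
  have "N x + haar_Lp p (W r l x) \<le> (1 + C * (1 + c)) * (N x + haar_Lp q (W (r + s) n x))" for x
  proof -
    define S where "S = haar_Lp q (W (r + s) n x)"
    have "dyadic_sum r n x 1 = (\<Sum>j. ennreal (2 powr (- s)) ^ j * W (r + s) n x ((1 / 2) ^ j * 1))"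
      using dyadic_sum_eq[of 1] by simp
    also have "\<dots> \<le> (\<Sum>j. ennreal (2 powr (- s)) ^ j * (ennreal (2 * 2 powr (r + s)) * S))"
      unfolding S_def using assms by (intro suminf_le mult_left_mono haar_Lp_W_ge) auto
    also have "\<dots> = c * S"
      using \<theta> by (simp add: c_def suminf_ennreal_geometric mult.assoc)
    finally have d: "dyadic_sum r n x 1 \<le> c * S" .
    have "haar_Lp p (W r l x) \<le> C * (N x + dyadic_sum r n x 1)"
      using C(2)[of 1 p x] assms by simp
    also have "\<dots> \<le> C * ((1 + c) * (N x + S))"
    proof (intro mult_left_mono)
      have "N x + dyadic_sum r n x 1 \<le> N x + c * S" using d by (rule add_left_mono)
      also have "\<dots> \<le> (N x + c * S) + (c * N x + S)" by simp
      also have "\<dots> = (1 + c) * (N x + S)" by (simp add: distrib_left distrib_right add_ac)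
      finally show "N x + dyadic_sum r n x 1 \<le> (1 + c) * (N x + S)" .
    qed simp
    finally have "N x + haar_Lp p (W r l x) \<le> (N x + S) + C * (1 + c) * (N x + S)"
      by (intro add_mono) (auto simp: mult.assoc)
    then show ?thesis by (simp add: S_def distrib_right)
  qed
  moreover have "1 + C * (1 + c) < top" using C by (simp add: c_def ennreal_mult_less_top)
  ultimately show ?thesis by blast
qed

text \<open>The bound \<open>besov_le_dyadic_sum\<close> is applied to b =
  \<open>(D t ^^ n) x\<close> at the scale h that limits t, and differences commute past the dyadic
  sum. The indicator summands form a step function comparable to N x times h^(-s) for h \<ge> 1,
  written as a geometric sum of dilates so that \<open>haar_Lp_geometric\<close> can treat both
  parts together.\<close>

lemma iterated_modulus_le:
  assumes "0 < r" "0 < s" "r < real l" "l \<le> n" "1 \<le> p"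
  shows "\<exists>C<top. \<forall>x h. 0 < h \<longrightarrow>
    flow_norm.W \<psi> (\<lambda>x. N x + haar_Lp p (W r l x)) s n x h \<le>
    C * (\<Sum>j. ennreal (2 powr (- s)) ^ j *
      (N x * indicator {1..<2 * 1} ((1 / 2) ^ j * h) + W (r + s) n x ((1 / 2) ^ j * h)))"
proof -
  define N1 where "N1 = (\<lambda>x. N x + haar_Lp p (W r l x))"
  interpret I: flow_norm \<psi> N1 K
    unfolding N1_def by (rule flow_norm_besov) fact
  obtain C where C: "C < top" "\<And>x h p. 0 < h \<Longrightarrow> 1 \<le> p \<Longrightarrow>
    haar_Lp p (W r l x) \<le> C * ennreal (h powr (- r)) * (N x + dyadic_sum r n x h)"
    using besov_le_dyadic_sum[OF assms(1,3,4)] by blast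
  define C' where "C' = C * (1 + (K + 1) ^ n)"
  define E where "E = (K + 1) ^ n + 1 + C'"
  have "I.W s n x h \<le> E * (\<Sum>j. ennreal (2 powr (- s)) ^ j *
      (N x * indicator {1..<2 * 1} ((1 / 2) ^ j * h) + W (r + s) n x ((1 / 2) ^ j * h)))" (is "_ \<le> E * ?V")
    if h: "0 < h" for x h
  proof -
    define d where "d = dyadic_sum r n x h"
    have \<omega>d: "\<omega> n h x \<le> d"
      using ennreal_le_suminf[of "\<lambda>j. ennreal (2 powr r) ^ j * \<omega> n ((1 / 2) ^ j * h) x" 0]
      by (simp add: d_def dyadic_sum_def)
    have "I.\<omega> n h x \<le> \<omega> n h x + C' * (ennreal (h powr (- r)) * d)"
    proof (rule I.modulus_least)
      fix t :: "real ^ 'd" assume t: "(\<Sum>j\<in>UNIV. \<bar>t $ j\<bar>) \<le> h"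
      define b where "b = (D t ^^ n) x"
      have Nb: "N b \<le> \<omega> n h x" unfolding b_def by (rule modulus_upper[OF t])
      have db: "dyadic_sum r n b h \<le> (K + 1) ^ n * d"
        unfolding dyadic_sum_def d_def b_def ennreal_suminf_cmult[symmetric] mult.left_commute[of "(K + 1) ^ n"]
        by (intro suminf_le mult_left_mono modulus_Dpow) auto
      have "N1 b \<le> N b + C * ennreal (h powr (- r)) * (N b + dyadic_sum r n b h)"
        unfolding N1_def using h assms by (intro add_left_mono C) auto
      also have "\<dots> \<le> \<omega> n h x + C * ennreal (h powr (- r)) * (d + (K + 1) ^ n * d)"
        using order_trans[OF Nb \<omega>d] by (intro add_mono mult_left_mono Nb db) auto
      also have "d + (K + 1) ^ n * d = (1 + (K + 1) ^ n) * d" by (simp add: distrib_right)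
      also have "C * ennreal (h powr (- r)) * ((1 + (K + 1) ^ n) * d) = C' * (ennreal (h powr (- r)) * d)"
        unfolding C'_def by (simp only: mult_ac)
      finally show "N1 ((D t ^^ n) x) \<le> \<omega> n h x + C' * (ennreal (h powr (- r)) * d)"
        by (simp add: b_def)
    qed
    then have "I.W s n x h \<le> ennreal (h powr (- s)) * (\<omega> n h x + C' * (ennreal (h powr (- r)) * d))"
      unfolding I.W_def by (rule mult_left_mono) simp
    also have "\<dots> = ennreal (h powr (- s)) * \<omega> n h x
        + C' * ((ennreal (h powr (- s)) * ennreal (h powr (- r))) * d)"
      unfolding distrib_left by (simp only: mult_ac)
    also have "ennreal (h powr (- s)) * ennreal (h powr (- r)) = ennreal (h powr (- (r + s)))"
      by (simp add: add.commute[of r] flip: ennreal_mult powr_add)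
    finally have W: "I.W s n x h \<le> ennreal (h powr (- s)) * \<omega> n h x + C' * (ennreal (h powr (- (r + s))) * d)" .
    have d: "ennreal (h powr (- (r + s))) * d \<le> ?V"
      unfolding d_def dyadic_sum_eq[OF h] by (intro suminf_le mult_left_mono) auto
    \<comment> \<open>This term comes from the summand N b. For h < 1 it is absorbed since h^(-s)
      \<le> h^(-(r+s)). For h \<ge> 1 the modulus is at most a multiple of N x, and the indicator
      selects the j with 2^j \<le> h < 2^(j+1).\<close>
    have "ennreal (h powr (- s)) * \<omega> n h x \<le> ((K + 1) ^ n + 1) * ?V"
    proof (cases "h < 1")
      case True
      have "h powr (- s) \<le> h powr (- (r + s))"
        using True h assms by (intro powr_mono') auto
      then have "ennreal (h powr (- s)) * \<omega> n h x \<le> ennreal (h powr (- (r + s))) * d"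
        using \<omega>d by (intro mult_mono ennreal_leI) auto
      also have "\<dots> \<le> 1 * ?V" using d by simp
      also have "\<dots> \<le> ((K + 1) ^ n + 1) * ?V" by (intro mult_right_mono) auto
      finally show ?thesis .
    next
      case False
      have "\<exists>j. 2 ^ j \<le> h \<and> h < 2 * 2 ^ j"
        using zero_less_one h
      proof (cases rule: dyadic_cover)
        case (2 j)
        have "(1 / 2 :: real) ^ j \<le> 1" by (rule power_le_one) auto
        then show ?thesis using 2 False by simp
      qed auto
      then obtain j where j: "2 ^ j \<le> h" "h < 2 * 2 ^ j" by blast
      have "h powr (- s) \<le> (2 ^ j) powr (- s)"
        using j assms by (intro powr_mono2') auto
      also have "(2 ^ j) powr (- s) = (2 powr (- s)) ^ j"
        by (rule power_powr_swap) simp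
      finally have hs: "ennreal (h powr (- s)) \<le> ennreal (2 powr (- s)) ^ j"
        by (simp add: ennreal_power ennreal_leI)
      have ind: "(1 / 2) ^ j * h \<in> {1..<2 * 1}"
        using j by (auto simp: power_one_over field_simps)
      have "ennreal (h powr (- s)) * \<omega> n h x \<le> ennreal (2 powr (- s)) ^ j * ((K + 1) ^ n * N x)"
        using hs modulus_le by (intro mult_mono) auto
      also have "\<dots> \<le> (K + 1) ^ n * (ennreal (2 powr (- s)) ^ j *
          (N x * indicator {1..<2 * 1} ((1 / 2) ^ j * h) + W (r + s) n x ((1 / 2) ^ j * h)))"
        using ind by (subst mult.left_commute) (auto intro!: mult_left_mono)
      also have "\<dots> \<le> (K + 1) ^ n * ?V"
        by (intro mult_left_mono ennreal_le_suminf) auto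
      also have "\<dots> \<le> ((K + 1) ^ n + 1) * ?V" by (intro mult_right_mono) auto
      finally show ?thesis .
    qed
    then have "I.W s n x h \<le> ((K + 1) ^ n + 1) * ?V + C' * ?V"
      by (intro order_trans[OF W] add_mono mult_left_mono d) auto
    then show ?thesis by (simp only: E_def distrib_right)
  qed
  moreover have "E < top"
    using C K1_finite[of n] by (simp add: E_def C'_def ennreal_mult_less_top)
  ultimately show ?thesis unfolding N1_def by blast
qed

text \<open>The embedding bounds the inner norm of x, and \<open>iterated_modulus_le\<close>
  integrated over h bounds the outer seminorm.\<close>

lemma iterated_le_besov:
  assumes "0 < r" "0 < s" "r < real l" "s < real m" "1 \<le> p" "1 \<le> q"
  shows "\<exists>C<top. \<forall>x. (N x + haar_Lp p (W r l x))
      + haar_Lp q (flow_norm.W \<psi> (\<lambda>x. N x + haar_Lp p (W r l x)) s m x) \<le>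
    C * (N x + haar_Lp q (W (r + s) k x))"
proof -
  define N1 where "N1 = (\<lambda>x. N x + haar_Lp p (W r l x))"
  interpret I: flow_norm \<psi> N1 K
    unfolding N1_def by (rule flow_norm_besov) fact
  \<comment> \<open>One order serving all estimates: n \<ge> l for the dyadic bounds, n \<ge> m to
    raise the outer order, n \<ge> k to return to the given modulus, and n > r + s because l > r and
    m > s.\<close>
  define n where "n = l + m + k"
  define \<theta> where "\<theta> = 2 powr (- s)"
  have "2 powr (- s) < 2 powr 0" using assms by (intro powr_less_mono) auto
  then have \<theta>: "0 \<le> \<theta>" "\<theta> < 1" by (auto simp: \<theta>_def)
  obtain C1 where C1: "C1 < top" "\<And>x. N1 x \<le> C1 * (N x + haar_Lp q (W (r + s) n x))"
    using besov_embedding[of r s l n p q] assms by (auto simp: n_def N1_def)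
  obtain C2 where C2: "C2 < top" "\<And>x. N1 x + haar_Lp q (I.W s m x) \<le> C2 * (N1 x + haar_Lp q (I.W s n x))"
    using I.besov_order[of s m n] assms by (auto simp: n_def)
  obtain C3 where C3: "C3 < top" "\<And>x h. 0 < h \<Longrightarrow> I.W s n x h \<le>
    C3 * (\<Sum>j. ennreal \<theta> ^ j * (N x * indicator {1..<2 * 1} ((1 / 2) ^ j * h) + W (r + s) n x ((1 / 2) ^ j * h)))"
    using iterated_modulus_le[of r s l n p] assms by (auto simp: n_def N1_def \<theta>_def)
  define E where "E = C3 * ennreal (1 / (1 - \<theta>))"
  have L: "haar_Lp q (I.W s n x) \<le> E * (N x + haar_Lp q (W (r + s) n x))" for x
  proof -
    \<comment> \<open>Both contributions are collected in one function, whose dilates by 2^(-j) make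
      up the pointwise bound.\<close>
    define g where "g u = N x * indicator {1..<2 * 1} u + W (r + s) n x u" for u :: real
    have [measurable]: "g \<in> borel_measurable borel" unfolding g_def[abs_def] by measurable
    have "haar_Lp q (I.W s n x) \<le> haar_Lp q (\<lambda>h. C3 * (\<Sum>j. ennreal \<theta> ^ j * g ((1 / 2) ^ j * h)))"
      unfolding g_def by (intro haar_Lp_mono C3)
    also have "\<dots> = C3 * haar_Lp q (\<lambda>h. \<Sum>j. ennreal \<theta> ^ j * g ((1 / 2) ^ j * h))"
      using assms by (intro haar_Lp_cmult) auto
    also have "\<dots> \<le> C3 * (ennreal (1 / (1 - \<theta>)) * haar_Lp q g)"
      using \<theta> assms by (intro mult_left_mono haar_Lp_geometric) auto
    also have "haar_Lp q g \<le> haar_Lp q (\<lambda>u. N x * indicator {1..<2 * 1} u) + haar_Lp q (W (r + s) n x)"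
      unfolding g_def[abs_def] using assms by (intro haar_Lp_add) auto
    also have "haar_Lp q (\<lambda>u. N x * indicator {1..<2 * 1} u) = N x * haar_Lp q (indicator {1..<2 * 1})"
      using assms by (intro haar_Lp_cmult) auto
    also have "\<dots> \<le> N x * 1"
      using assms haar_Lp_indicator_dyadic(1)[of 1 q] by (intro mult_left_mono) auto
    finally show ?thesis by (simp add: E_def mult.assoc mult_left_mono)
  qed
  define C4 where "C4 = (K + 1) ^ (l + m)"
  have "N1 x + haar_Lp q (I.W s m x) \<le> (C2 * (C1 + E) * (1 + C4)) * (N x + haar_Lp q (W (r + s) k x))" for x
  proof -
    have "N x + haar_Lp q (W (r + s) n x) \<le> N x + C4 * haar_Lp q (W (r + s) k x)"
      unfolding n_def C4_def using assms by (intro add_left_mono besov_add_order) auto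
    also have "\<dots> \<le> (N x + C4 * haar_Lp q (W (r + s) k x)) + (C4 * N x + haar_Lp q (W (r + s) k x))"
      by simp
    also have "\<dots> = (1 + C4) * (N x + haar_Lp q (W (r + s) k x))"
      by (simp add: distrib_left distrib_right add_ac)
    finally have 4: "N x + haar_Lp q (W (r + s) n x) \<le> \<dots>" .
    have "N1 x + haar_Lp q (I.W s m x) \<le> C2 * (N1 x + haar_Lp q (I.W s n x))" by (rule C2)
    also have "\<dots> \<le> C2 * (C1 * (N x + haar_Lp q (W (r + s) n x)) + E * (N x + haar_Lp q (W (r + s) n x)))"
      by (intro mult_left_mono add_mono C1 L) auto
    also have "\<dots> = C2 * (C1 + E) * (N x + haar_Lp q (W (r + s) n x))"
      by (simp add: distrib_right mult.assoc)
    also have "\<dots> \<le> C2 * (C1 + E) * ((1 + C4) * (N x + haar_Lp q (W (r + s) k x)))"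
      by (intro mult_left_mono 4) auto
    finally show ?thesis by (simp only: mult.assoc)
  qed
  moreover have "C2 * (C1 + E) * (1 + C4) < top"
    using C1 C2 C3 K1_finite by (simp add: E_def C4_def ennreal_mult_less_top)
  ultimately show ?thesis unfolding N1_def by blast
qed

section \<open>Passage from the abstract estimates to the Banach algebra\<close>

lemma besov_norm_eq: "besov_norm \<psi> p r N = (\<lambda>x. N x + haar_Lp p (W r (nat \<lfloor>r\<rfloor> + 1) x))"
  by (auto simp: besov_norm_def besov_seminorm_def haar_Lp_def W_def Let_def fun_eq_iff)

end

lemma (in automorphism_group) flow_norm_algebra_norm: "\<exists>K. flow_norm \<psi> algebra_norm K"
proof -
  obtain M where M: "onorm (\<psi> t) \<le> M" for t
    using uniformly_bounded by (auto simp: bdd_above_def)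
  have lin: "bounded_linear (\<psi> t)" for t
    using automorphism by (simp add: banach_algebra_automorphism_def)
  have "flow_norm \<psi> algebra_norm (ennreal M)"
  proof (intro flow_norm.intro linear_flow.intro flow_norm_axioms.intro)
    show "linear (\<psi> t)" for t using lin by (rule bounded_linear.linear)
    show "\<psi> s (\<psi> t x) = \<psi> (s + t) x" for s t x using group_law[of s t] by (metis comp_apply)
    show "algebra_norm (x + y) \<le> algebra_norm x + algebra_norm y" for x y :: 'a
      by (simp add: norm_triangle_ineq ennreal_leI flip: ennreal_plus)
    show "algebra_norm (c *\<^sub>R x) \<le> ennreal \<bar>c\<bar> * algebra_norm x" for c and x :: 'a
      by (simp add: ennreal_mult)
    show "algebra_norm (\<psi> t x) \<le> ennreal M * algebra_norm x" for t x
    proof -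
      have "norm (\<psi> t x) \<le> M * norm x"
        using onorm[OF lin, of t x] mult_right_mono[OF M[of t], of "norm x"] by simp
      moreover have "0 \<le> M" using onorm_pos_le[OF lin] M by (rule order_trans)
      ultimately show ?thesis by (simp add: ennreal_leI flip: ennreal_mult)
    qed
  qed simp
  then show ?thesis ..
qed

text \<open>The two inequalities hold for all x, including those of infinite norm, so finiteness of
  either norm forces finiteness of the other; equality of the spaces comes along with
  equivalence.\<close>

lemma equivalent_norms_intro:
  assumes "C < top" "\<And>x. N x \<le> C * N' x" and "C' < top" "\<And>x. N' x \<le> C' * N x"
  shows "space_of_norm N = space_of_norm N' \<and> equivalent_norms_on X N N'"
proof
  show "space_of_norm N = space_of_norm N'"
  proof -
    have "N x < top \<longleftrightarrow> N' x < top" for x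
    proof
      assume "N x < top"
      then have "C' * N x < top" using assms(3) by (simp add: ennreal_mult_less_top)
      with assms(4) show "N' x < top" by (rule le_less_trans)
    next
      assume "N' x < top"
      then have "C * N' x < top" using assms(1) by (simp add: ennreal_mult_less_top)
      with assms(2) show "N x < top" by (rule le_less_trans)
    qed
    then show ?thesis by (simp add: space_of_norm_def)
  qed
  \<comment> \<open>A constant C may be zero; adding 1 makes the real constants strictly positive
    and the division by c legitimate.\<close>
  define c where "c = enn2real C + 1"
  define c' where "c' = enn2real C' + 1"
  have c: "0 < c" "C \<le> ennreal c" and c': "0 < c'" "C' \<le> ennreal c'"
    using assms by (auto simp: c_def c'_def add_nonneg_pos ennreal_enn2real_if)
  have "ennreal (1 / c) * N x \<le> N' x \<and> N' x \<le> ennreal c' * N x" for x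
  proof
    have "ennreal (1 / c) * N x \<le> ennreal (1 / c) * (ennreal c * N' x)"
      using c by (intro mult_left_mono order_trans[OF assms(2)] mult_right_mono) auto
    also have "\<dots> = N' x" using c by (simp flip: mult.assoc ennreal_mult)
    finally show "ennreal (1 / c) * N x \<le> N' x" .
    show "N' x \<le> ennreal c' * N x"
      by (intro order_trans[OF assms(4)] mult_right_mono c') auto
  qed
  then show "equivalent_norms_on X N N'"
    unfolding equivalent_norms_on_def using c c' by (intro exI[of _ "1 / c"] exI[of _ c']) auto
qed

theorem theorem3p7:
  fixes \<psi> :: "real ^ 'd \<Rightarrow> 'a::complex_banach_algebra \<Rightarrow> 'a"
    and p q :: ennreal and r s :: real
  assumes "automorphism_group \<psi>"
    and "1 \<le> p" "p \<le> \<infinity>" "1 \<le> q" "q \<le> \<infinity>" "0 < r" "0 < s"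
  shows "space_of_norm (besov_norm \<psi> q s (besov_norm \<psi> p r algebra_norm)) =
           space_of_norm (besov_norm \<psi> q (r + s) algebra_norm)
       \<and> equivalent_norms_on (space_of_norm (besov_norm \<psi> q (r + s) algebra_norm))
           (besov_norm \<psi> q s (besov_norm \<psi> p r algebra_norm))
           (besov_norm \<psi> q (r + s) algebra_norm)"
proof -
  obtain K where "flow_norm \<psi> algebra_norm K"
    using automorphism_group.flow_norm_algebra_norm[OF assms(1)] by blast
  then interpret flow_norm \<psi> algebra_norm K .
  \<comment> \<open>This is the order prescribed by \<open>besov_seminorm\<close>. In general k (r +
    s) differs from k r + k s, which the estimates allow since they treat the three orders
    independently.\<close>
  define k where "k u = nat \<lfloor>u\<rfloor> + 1" for u :: real
  have k: "u < real (k u)" for u unfolding k_def by linarith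
  define N1 where "N1 = (\<lambda>x. algebra_norm x + haar_Lp p (W r (k r) x))"
  interpret I: flow_norm \<psi> N1 K
    unfolding N1_def by (rule flow_norm_besov) fact
  have N1: "besov_norm \<psi> p r algebra_norm = N1"
    by (simp add: besov_norm_eq N1_def k_def)
  have N2: "besov_norm \<psi> q s N1 = (\<lambda>x. N1 x + haar_Lp q (I.W s (k s) x))"
    by (simp add: I.besov_norm_eq k_def)
  have N3: "besov_norm \<psi> q (r + s) algebra_norm = (\<lambda>x. algebra_norm x + haar_Lp q (W (r + s) (k (r + s)) x))"
    by (simp add: besov_norm_eq k_def)
  obtain C where "C < top" "\<And>x. besov_norm \<psi> q s N1 x \<le> C * besov_norm \<psi> q (r + s) algebra_norm x"
    using iterated_le_besov[of r s "k r" "k s" p q "k (r + s)"] assms k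
    unfolding N2 N3 N1_def[symmetric] by (auto simp: N1_def)
  moreover obtain C' where "C' < top" "\<And>x. besov_norm \<psi> q (r + s) algebra_norm x \<le> C' * besov_norm \<psi> q s N1 x"
    using besov_le_iterated[of r s "k (r + s)" p q "k r" "k s"] assms k
    unfolding N2 N3 N1_def[symmetric] by (auto simp: N1_def)
  ultimately show ?thesis unfolding N1 by (rule equivalent_norms_intro)
qed

end
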